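(* The categories of median algebras and Stone poc sets are anti equivalent (via the functors $M\mapsto M^\circ$ and $P\mapsto P^\bullet$). The evaluation maps $ev: M\to M^{\circ\bullet}$, $ev(x)=\{H\in M^\circ\mid x\in H\}$, and $ev: P\to P^{\bullet\circ}$, $ev(a)=\{U\in P^\bullet\mid a\in U\}$, induce isomorphisms of median algebras and Stone poc sets, respectively, for every median algebra $M$ and every Stone poc set $P$.
   Context: A median algebra is a set $M$ (standing convention: nonempty) with a map $m: M^3\to M$ such that: $m(x,y,z)=m(x,z,y)=m(y,z,x)$; $m(x,x,y)=x$; $m(m(x,y,z),u,v)=m(x,m(y,u,v),m(z,u,v))$. A median morphism is a map preserving $m$. A subset $C$ is convex if $m(x,y,z)\in C$ for all $x,y\in C$, $z\in M$; a half space is a subset $H$ with $H$ and $M\setminus H$ both convex (equivalently, the support of a median morphism $M\to\mathbf{2}=\{0,1\}$, where $\mathbf 2$ has the majority median). A poc set is a partially ordered set $P$ with a smallest element $0$ and an involution $^*$ such that $a\le b\Rightarrow b^*\le a^*$, and $a\le a^*\Rightarrow a=0$; standing convention: $0\neq0^*$. A poc morphism is a monotone map fixing $0$ and commuting with $^*$. An ultra filter in $P$ is an upper set $U\subset P$ such that $P$ is the disjoint union of $U$ and $U^*=\{a^*: a\in U\}$ (equivalently, the support of a poc morphism $P\to\mathbf{2}$, where $0<1=0^*$). A Stone space is a compact Hausdorff totally disconnected space. A Stone poc set is a poc set $P$ endowed with a Stone topology such that for all $a,b\in P$ with $a\not\le b$ there is a clopen ultra filter $U\subset P$ with $a,b^*\in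 U$. Morphisms of Stone poc sets are continuous poc morphisms. For a median algebra $M$, $M^\circ$ is the set of half spaces of $M$, a poc set under inclusion with $H^*=M\setminus H$ and $0=\varnothing$, with the (Stone) topology with subbasis $\{V(x),\,M^\circ\setminus V(x): x\in M\}$, $V(x)=\{H\in M^\circ: x\in H\}$; it is a Stone poc set. For a Stone poc set $P$, $P^\bullet$ is the set of clopen ultra filters of $P$ (equivalently, continuous poc morphisms $P\to\mathbf{2}$, with $\mathbf{2}$ discrete) with the Boolean median $m(U,V,W)=(U\cap V)\cup(V\cap W)\cup(W\cap U)$. Both constructions act on morphisms by taking preimages. *)

theory Defs
  imports "HOL-Analysis.Analysis" "HOL-Algebra.Congruence"
begin

section \<open>Median algebras\<close>

record 'a median_struct = "'a partial_object" +
  med :: "'a \<Rightarrow> 'a \<Rightarrow> 'a \<Rightarrow> 'a"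

locale median_algebra =
  fixes M :: "('a, 'm) median_struct_scheme"
  assumes nonempty: "carrier M \<noteq> {}"
    and med_closed: "\<lbrakk>x \<in> carrier M; y \<in> carrier M; z \<in> carrier M\<rbrakk> \<Longrightarrow> med M x y z \<in> carrier M"
    and med_swap: "\<lbrakk>x \<in> carrier M; y \<in> carrier M; z \<in> carrier M\<rbrakk> \<Longrightarrow> med M x y z = med M x z y"
    and med_rotate: "\<lbrakk>x \<in> carrier M; y \<in> carrier M; z \<in> carrier M\<rbrakk> \<Longrightarrow> med M x z y = med M y z x"
    and med_majority: "\<lbrakk>x \<in> carrier M; y \<in> carrier M\<rbrakk> \<Longrightarrow> med M x x y = x"
    and med_distrib: "\<lbrakk>x \<in> carrier M; y \<in> carrier M; z \<in> carrier M; u \<in> carrier M; v \<in> carrier M\<rbrakk>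
      \<Longrightarrow> med M (med M x y z) u v = med M x (med M y u v) (med M z u v)"

definition median_convex :: "('a, 'm) median_struct_scheme \<Rightarrow> 'a set \<Rightarrow> bool" where
  "median_convex M C \<longleftrightarrow>
     C \<subseteq> carrier M \<and> (\<forall>x\<in>C. \<forall>y\<in>C. \<forall>z\<in>carrier M. med M x y z \<in> C)"

definition half_space :: "('a, 'm) median_struct_scheme \<Rightarrow> 'a set \<Rightarrow> bool" where
  "half_space M H \<longleftrightarrow>
     H \<subseteq> carrier M \<and> median_convex M H \<and> median_convex M (carrier M - H)"

text \<open>
  Morphisms are extensional functions (equal to \<^term>\<open>undefined\<close> off the carrier), so that equality
  of morphisms is equality in HOL; composition is \<^const>\<open>compose\<close> and the identity of \<open>M\<close> is
  \<open>\<lambda>x\<in>carrier M. x\<close>.  Hom-sets are defined between structures over different types: a HOL type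
  cannot be closed under power sets, so the category is the type-polymorphic family of all
  structures.
\<close>

definition median_hom ::
  "('a, 'm) median_struct_scheme \<Rightarrow> ('b, 'n) median_struct_scheme \<Rightarrow> ('a \<Rightarrow> 'b) set" where
  "median_hom M N = {f \<in> carrier M \<rightarrow>\<^sub>E carrier N.
     \<forall>x\<in>carrier M. \<forall>y\<in>carrier M. \<forall>z\<in>carrier M. f (med M x y z) = med N (f x) (f y) (f z)}"

definition median_iso ::
  "('a, 'm) median_struct_scheme \<Rightarrow> ('b, 'n) median_struct_scheme \<Rightarrow> ('a \<Rightarrow> 'b) \<Rightarrow> bool" where
  "median_iso M N f \<longleftrightarrow> f \<in> median_hom M N \<and>
     (\<exists>g\<in>median_hom N M. compose (carrier M) g f = (\<lambda>x\<in>carrier M. x) \<and>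
                         compose (carrier N) f g = (\<lambda>y\<in>carrier N. y))"

lemma median_hom_id:
  assumes "median_algebra M"
  shows "(\<lambda>x\<in>carrier M. x) \<in> median_hom M M"
  using median_algebra.med_closed[OF assms] by (auto simp: median_hom_def)

lemma median_hom_compose:
  assumes "median_algebra L" "f \<in> median_hom L M" "g \<in> median_hom M N"
  shows "compose (carrier L) g f \<in> median_hom L N"
proof -
  have "f x \<in> carrier M" if "x \<in> carrier L" for x
    using assms(2) that by (auto simp: median_hom_def)
  moreover have "g y \<in> carrier N" if "y \<in> carrier M" for y
    using assms(3) that by (auto simp: median_hom_def)
  ultimately show ?thesis
    using assms(2,3) median_algebra.med_closed[OF assms(1)]
    by (simp add: median_hom_def compose_def)
qed


section \<open>Stone poc sets\<close>

record 'a poc_struct = "'a partial_object" +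
  ple :: "'a \<Rightarrow> 'a \<Rightarrow> bool"
  pzero :: 'a
  pstar :: "'a \<Rightarrow> 'a"

record 'a stone_poc_struct = "'a poc_struct" +
  ptop :: "'a topology"

locale poc_set =
  fixes P :: "('a, 'm) poc_struct_scheme"
  assumes ple_refl: "reflp_on (carrier P) (ple P)"
    and ple_antisym: "antisymp_on (carrier P) (ple P)"
    and ple_trans: "transp_on (carrier P) (ple P)"
    and zero_closed: "pzero P \<in> carrier P"
    and zero_least: "a \<in> carrier P \<Longrightarrow> ple P (pzero P) a"
    and star_closed: "a \<in> carrier P \<Longrightarrow> pstar P a \<in> carrier P"
    and star_star: "a \<in> carrier P \<Longrightarrow> pstar P (pstar P a) = a"
    and star_antimono: "\<lbrakk>a \<in> carrier P; b \<in> carrier P; ple P a b\<rbrakk> \<Longrightarrow> ple P (pstar P b) (pstar P a)"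
    and le_star_zero: "\<lbrakk>a \<in> carrier P; ple P a (pstar P a)\<rbrakk> \<Longrightarrow> a = pzero P"
    and zero_neq_star: "pzero P \<noteq> pstar P (pzero P)"

definition ultra_filter :: "('a, 'm) poc_struct_scheme \<Rightarrow> 'a set \<Rightarrow> bool" where
  "ultra_filter P U \<longleftrightarrow>
     U \<subseteq> carrier P \<and>
     (\<forall>a\<in>U. \<forall>b\<in>carrier P. ple P a b \<longrightarrow> b \<in> U) \<and>
     U \<inter> pstar P ` U = {} \<and> U \<union> pstar P ` U = carrier P"

definition clopen_ultra_filter :: "('a, 'm) stone_poc_struct_scheme \<Rightarrow> 'a set \<Rightarrow> bool" where
  "clopen_ultra_filter P U \<longleftrightarrow> ultra_filter P U \<and> openin (ptop P) U \<and> closedin (ptop P) U"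

definition totally_disconnected_space :: "'a topology \<Rightarrow> bool" where
  "totally_disconnected_space X \<longleftrightarrow> (\<forall>S. connectedin X S \<longrightarrow> (\<exists>x. S \<subseteq> {x}))"

definition Stone_space :: "'a topology \<Rightarrow> bool" where
  "Stone_space X \<longleftrightarrow> compact_space X \<and> Hausdorff_space X \<and> totally_disconnected_space X"

locale stone_poc_set = poc_set P for P :: "('a, 'm) stone_poc_struct_scheme" +
  assumes topspace_eq: "topspace (ptop P) = carrier P"
    and Stone: "Stone_space (ptop P)"
    and separation: "\<lbrakk>a \<in> carrier P; b \<in> carrier P; \<not> ple P a b\<rbrakk>
      \<Longrightarrow> \<exists>U. clopen_ultra_filter P U \<and> a \<in> U \<and> pstar P b \<in> U"

definition stone_poc_hom ::
  "('a, 'm) stone_poc_struct_scheme \<Rightarrow> ('b, 'n) stone_poc_struct_scheme \<Rightarrow> ('a \<Rightarrow> 'b) set" where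
  "stone_poc_hom P Q = {f \<in> carrier P \<rightarrow>\<^sub>E carrier Q.
     monotone_on (carrier P) (ple P) (ple Q) f \<and>
     f (pzero P) = pzero Q \<and>
     (\<forall>a\<in>carrier P. f (pstar P a) = pstar Q (f a)) \<and>
     continuous_map (ptop P) (ptop Q) f}"

definition stone_poc_iso ::
  "('a, 'm) stone_poc_struct_scheme \<Rightarrow> ('b, 'n) stone_poc_struct_scheme \<Rightarrow> ('a \<Rightarrow> 'b) \<Rightarrow> bool" where
  "stone_poc_iso P Q f \<longleftrightarrow> f \<in> stone_poc_hom P Q \<and>
     (\<exists>g\<in>stone_poc_hom Q P. compose (carrier P) g f = (\<lambda>a\<in>carrier P. a) \<and>
                            compose (carrier Q) f g = (\<lambda>b\<in>carrier Q. b))"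

lemma stone_poc_hom_id:
  assumes "stone_poc_set P"
  shows "(\<lambda>a\<in>carrier P. a) \<in> stone_poc_hom P P"
proof -
  interpret stone_poc_set P by (rule assms)
  have "continuous_map (ptop P) (ptop P) (\<lambda>a\<in>carrier P. a)"
    by (rule continuous_map_eq[OF continuous_map_id]) (simp add: topspace_eq)
  then show ?thesis
    by (auto simp: stone_poc_hom_def monotone_on_def zero_closed star_closed)
qed

lemma stone_poc_hom_compose:
  assumes "stone_poc_set P" "f \<in> stone_poc_hom P Q" "g \<in> stone_poc_hom Q R"
  shows "compose (carrier P) g f \<in> stone_poc_hom P R"
proof -
  interpret stone_poc_set P by (rule assms)
  have f: "f a \<in> carrier Q" if "a \<in> carrier P" for a
    using assms(2) that by (auto simp: stone_poc_hom_def)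
  have g: "g b \<in> carrier R" if "b \<in> carrier Q" for b
    using assms(3) that by (auto simp: stone_poc_hom_def)
  have "continuous_map (ptop P) (ptop R) (g \<circ> f)"
    using assms(2,3) by (auto simp: stone_poc_hom_def intro: continuous_map_compose)
  then have "continuous_map (ptop P) (ptop R) (compose (carrier P) g f)"
    by (rule continuous_map_eq) (simp add: topspace_eq compose_def)
  with f g show ?thesis
    using assms(2,3)
    by (simp add: stone_poc_hom_def compose_def monotone_on_def zero_closed star_closed)
qed


section \<open>The two functors and the evaluation maps\<close>

definition half_spaces_at :: "('a, 'm) median_struct_scheme \<Rightarrow> 'a \<Rightarrow> 'a set set" where
  "half_spaces_at M x = {H. half_space M H \<and> x \<in> H}"

text \<open>
  The subbasis below covers the set of all half spaces because a median algebra is nonempty, so the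
  generated topology lives on all of \<open>{H. half_space M H}\<close>.
\<close>

definition circ :: "('a, 'm) median_struct_scheme \<Rightarrow> 'a set stone_poc_struct" where
  "circ M = \<lparr>carrier = {H. half_space M H},
             ple = (\<subseteq>), pzero = {}, pstar = (\<lambda>H. carrier M - H),
             ptop = topology_generated_by
               (half_spaces_at M ` carrier M \<union>
                (\<lambda>x. {H. half_space M H} - half_spaces_at M x) ` carrier M)\<rparr>"

definition bullet :: "('a, 'm) stone_poc_struct_scheme \<Rightarrow> 'a set median_struct" where
  "bullet P = \<lparr>carrier = {U. clopen_ultra_filter P U},
               med = (\<lambda>U V W. (U \<inter> V) \<union> (V \<inter> W) \<union> (W \<inter> U))\<rparr>"

definition circ_map :: "('a, 'm) median_struct_scheme \<Rightarrow> ('b, 'n) median_struct_scheme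
    \<Rightarrow> ('a \<Rightarrow> 'b) \<Rightarrow> 'b set \<Rightarrow> 'a set" where
  "circ_map M N f = (\<lambda>H\<in>carrier (circ N). f -` H \<inter> carrier M)"

definition bullet_map :: "('a, 'm) stone_poc_struct_scheme \<Rightarrow> ('b, 'n) stone_poc_struct_scheme
    \<Rightarrow> ('a \<Rightarrow> 'b) \<Rightarrow> 'b set \<Rightarrow> 'a set" where
  "bullet_map P Q g = (\<lambda>U\<in>carrier (bullet Q). g -` U \<inter> carrier P)"

definition median_ev :: "('a, 'm) median_struct_scheme \<Rightarrow> 'a \<Rightarrow> 'a set set" where
  "median_ev M = (\<lambda>x\<in>carrier M. {H \<in> carrier (circ M). x \<in> H})"

definition poc_ev :: "('a, 'm) stone_poc_struct_scheme \<Rightarrow> 'a \<Rightarrow> 'a set set" where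
  "poc_ev P = (\<lambda>a\<in>carrier P. {U \<in> carrier (bullet P). a \<in> U})"

end

theory Submission
  imports Defs
begin

text \<open>
  Functoriality and naturality come down to the fact that preimages of half spaces and of clopen
  ultra filters are of the same kind.  The content of the duality is that there are enough half
  spaces, and that the two evaluation maps are onto.

  Enough half spaces: disjoint convex sets \<open>A\<close> and \<open>B\<close> are separated by a half space
  (\<open>half_space_separation\<close>).  By Zorn's lemma \<open>A\<close> and \<open>B\<close> may be taken maximal.  The join of a point
  \<open>x\<close> with a convex set is convex, so a point \<open>x\<close> outside both sets would make each of its joins meet
  the other set, and a Pasch property of intervals then yields a common point of both sets.

  The space of half spaces is compact.  By Alexander's theorem it suffices to consider subbasic
  families; the half spaces that such a family fails to cover are those that miss a certain set \<open>A\<close>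
  of points and contain another set \<open>B\<close>.  By separation there are none exactly when the convex hulls of
  \<open>A\<close> and \<open>B\<close> meet, and as hulls are finitary, finite parts of \<open>A\<close> and \<open>B\<close> then suffice.

  Every clopen ultra filter of half spaces is the set of half spaces at some point
  (\<open>clopen_ultra_filter_circ\<close>).  Being a clopen upper set of a compact space, it consists of the half
  spaces containing one of finitely many sets \<open>F\<close> of points.  The hulls of these sets meet
  pairwise, for a half space separating two of them would lie in the ultra filter together with its
  complement.  By the Helly property all the hulls have a common point, which is the desired one.

  Every half space \<open>H\<close> of clopen ultra filters of \<open>P\<close> is given by an element of \<open>P\<close>
  (\<open>half_space_bullet\<close>).  By compactness of \<open>P\<close> it is enough to find an element that lies in finitely
  many given members of \<open>H\<close> and outside finitely many given non-members.  Iterated medians, which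
  stay inside \<open>H\<close> and inside its complement, replace the members by one \<open>U\<close> and the
  non-members by one \<open>W\<close>, and any element of \<open>U - W\<close> will do (\<open>finite_separation\<close>).

  Evaluation on \<open>P\<close> reflects the order by the separation axiom, and its inverse is continuous because a
  continuous bijection from a compact space to a Hausdorff space is a homeomorphism.
\<close>

section \<open>Intervals and joins\<close>

context median_algebra
begin

lemma med_comm12:
  "\<lbrakk>x \<in> carrier M; y \<in> carrier M; z \<in> carrier M\<rbrakk> \<Longrightarrow> med M x y z = med M y x z"
  using med_rotate med_swap by metis

lemma med_comm13:
  "\<lbrakk>x \<in> carrier M; y \<in> carrier M; z \<in> carrier M\<rbrakk> \<Longrightarrow> med M x y z = med M z y x"
  using med_comm12 med_swap by metis

lemma med_majority12: "\<lbrakk>x \<in> carrier M; y \<in> carrier M\<rbrakk> \<Longrightarrow> med M x y x = x"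
  using med_swap med_majority by metis

lemma med_majority23: "\<lbrakk>x \<in> carrier M; y \<in> carrier M\<rbrakk> \<Longrightarrow> med M y x x = x"
  using med_comm12 med_majority12 by metis

definition interval :: "'a \<Rightarrow> 'a \<Rightarrow> 'a set" where
  "interval x y = {z \<in> carrier M. med M x y z = z}"

lemma intervalD: "z \<in> interval x y \<Longrightarrow> z \<in> carrier M \<and> med M x y z = z"
  by (simp add: interval_def)

lemma med_in_interval:
  assumes "x \<in> carrier M" "y \<in> carrier M" "z \<in> carrier M"
  shows "med M x y z \<in> interval x y"
proof -
  have "med M x y (med M x y z) = med M (med M z x y) x y"
    using assms by (metis med_closed med_comm12 med_comm13 med_swap)
  also have "\<dots> = med M z (med M x x y) (med M y x y)"
    using assms by (simp add: med_distrib)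
  also have "\<dots> = med M x y z"
    using assms by (metis med_comm12 med_swap med_majority med_majority12)
  finally show ?thesis
    using assms by (simp add: interval_def med_closed)
qed

lemma endpoint_in_interval:
  assumes "x \<in> carrier M" "y \<in> carrier M"
  shows "x \<in> interval x y" "y \<in> interval x y"
  using assms by (simp_all add: interval_def med_majority12 med_majority23)

lemma interval_trans:
  assumes "x \<in> carrier M" "c \<in> carrier M" "v \<in> interval x c" "u \<in> interval x v"
  shows "u \<in> interval x c"
proof -
  note [simp] = intervalD[OF assms(3)] intervalD[OF assms(4)]
  have "med M x c u = med M (med M u v x) x c"
    using assms(1,2) by (metis assms(3,4) intervalD med_closed med_comm12 med_comm13 med_swap)
  also have "\<dots> = med M u (med M v x c) (med M x x c)"
    using assms by (simp add: med_distrib)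
  also have "\<dots> = med M u v x"
    using assms(1,2) by (metis assms(3,4) intervalD med_comm12 med_comm13 med_swap med_majority)
  also have "\<dots> = u"
    using assms(1,2) by (metis assms(3,4) intervalD med_comm13 med_swap)
  finally show ?thesis
    by (simp add: interval_def)
qed

text \<open>
  Read in a distributive lattice with least element \<open>x\<close>: the point \<open>w\<close> between \<open>y\<close> and \<open>b\<close> lies below
  \<open>c \<squnion> b\<close>, hence below the median of \<open>c\<close>, \<open>b\<close> and \<open>w\<close>.  In general it is the distributive law
  for \<open>w\<close>, written as a median of \<open>y\<close>, \<open>b\<close> and itself.  Using it twice moves both ends of an
  interval outwards, seen from \<open>x\<close>, which is the key to the convexity of joins.
\<close>

lemma interval_push:
  assumes "x \<in> carrier M" "c \<in> carrier M" "b \<in> carrier M"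
    and y: "y \<in> interval x c" and w: "w \<in> interval y b"
  shows "w \<in> interval x (med M c b w)"
proof -
  have M: "y \<in> carrier M" "w \<in> carrier M"
    using y w by (simp_all add: interval_def)
  have "w = med M (med M x c y) b w"
    using assms(1-3) M intervalD[OF y] intervalD[OF w] by metis
  also have "\<dots> = med M x (med M c b w) (med M y b w)"
    using assms(1-3) M by (simp add: med_distrib)
  also have "\<dots> = med M x (med M c b w) w"
    using intervalD[OF w] by simp
  finally show ?thesis
    using M by (simp add: interval_def)
qed

text \<open>
  In a triangle with vertices \<open>x\<close>, \<open>c\<close> and \<open>d\<close> the median lies between \<open>c\<close> and any point of the
  opposite side from \<open>x\<close> to \<open>d\<close>.  By symmetry it also lies between \<open>d\<close> and any point of the side from \<open>x\<close> to
  \<open>c\<close>, so that the two transversals cross.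
\<close>

lemma interval_Pasch:
  assumes "x \<in> carrier M" "c \<in> carrier M" "d \<in> carrier M" and y: "y \<in> interval x d"
  shows "med M x c d \<in> interval c y"
proof -
  have M: "y \<in> carrier M" and z: "med M x c d \<in> carrier M"
    using assms by (simp_all add: interval_def med_closed)
  have "med M c y (med M x c d) = med M (med M y x d) c (med M x c d)"
    using assms(1-3) M z intervalD[OF y] by (metis med_comm12 med_swap)
  also have "\<dots> = med M y (med M x c (med M x c d)) (med M d c (med M x c d))"
    using assms(1-3) M z by (simp add: med_distrib)
  also have "med M x c (med M x c d) = med M x c d"
    using assms(1-3) med_in_interval intervalD by simp
  also have "med M d c (med M x c d) = med M x c d"
    using assms(1-3) med_in_interval[of d c x] intervalD[of "med M d c x" d c]
    by (metis med_comm13)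
  also have "med M y (med M x c d) (med M x c d) = med M x c d"
    using M z by (simp add: med_majority23)
  finally show ?thesis
    using z by (simp add: interval_def)
qed

lemma convexD:
  "\<lbrakk>median_convex M C; x \<in> C; y \<in> C; z \<in> carrier M\<rbrakk> \<Longrightarrow> med M x y z \<in> C"
  by (simp add: median_convex_def)

lemma convex_interval_subset: "\<lbrakk>median_convex M C; x \<in> C; y \<in> C\<rbrakk> \<Longrightarrow> interval x y \<subseteq> C"
  using convexD by (fastforce simp: interval_def)

lemma convex_Inter:
  "\<lbrakk>\<C> \<noteq> {}; \<And>C. C \<in> \<C> \<Longrightarrow> median_convex M C\<rbrakk> \<Longrightarrow> median_convex M (\<Inter>\<C>)"
  by (fastforce simp: median_convex_def)

lemma convex_Int:
  "\<lbrakk>median_convex M C; median_convex M D\<rbrakk> \<Longrightarrow> median_convex M (C \<inter> D)"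
  by (auto simp: median_convex_def)

lemma convex_directed_Union:
  assumes "\<And>C. C \<in> \<C> \<Longrightarrow> median_convex M C"
    and "\<And>C D. \<lbrakk>C \<in> \<C>; D \<in> \<C>\<rbrakk> \<Longrightarrow> \<exists>E\<in>\<C>. C \<union> D \<subseteq> E"
  shows "median_convex M (\<Union>\<C>)"
  unfolding median_convex_def
proof (intro conjI ballI)
  show "\<Union>\<C> \<subseteq> carrier M"
    using assms(1) by (auto simp: median_convex_def)
next
  fix x y z assume "x \<in> \<Union>\<C>" "y \<in> \<Union>\<C>" and z: "z \<in> carrier M"
  then obtain E where "E \<in> \<C>" "x \<in> E" "y \<in> E"
    using assms(2) by blast
  then show "med M x y z \<in> \<Union>\<C>"
    using assms(1) convexD z by blast
qed

text \<open>
  The union of the intervals from \<open>x\<close> to the points of \<open>C\<close> is the join of \<open>x\<close> and \<open>C\<close>.  It is the only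
  convex set bigger than \<open>C\<close> that the separation argument needs.
\<close>

lemma convex_join:
  assumes "x \<in> carrier M" and C: "median_convex M C"
  shows "median_convex M (\<Union>c\<in>C. interval x c)"
  unfolding median_convex_def
proof (intro conjI ballI)
  show "(\<Union>c\<in>C. interval x c) \<subseteq> carrier M"
    by (auto simp: interval_def)
next
  fix y1 y2 z
  assume "y1 \<in> (\<Union>c\<in>C. interval x c)" "y2 \<in> (\<Union>c\<in>C. interval x c)" and z: "z \<in> carrier M"
  then obtain c1 c2 where c: "c1 \<in> C" "c2 \<in> C" and y: "y1 \<in> interval x c1" "y2 \<in> interval x c2"
    by blast
  have CM: "c1 \<in> carrier M" "c2 \<in> carrier M"
    using c C by (auto simp: median_convex_def)
  have yM: "y1 \<in> carrier M" "y2 \<in> carrier M"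
    using y by (simp_all add: interval_def)
  define w where "w = med M y1 y2 z"
  have w: "w \<in> interval y1 y2"
    using yM z by (simp add: w_def med_in_interval)
  then have wM: "w \<in> carrier M"
    by (simp add: interval_def)
  \<comment> \<open>One end is moved at a time: from \<open>y1\<close> to \<open>c1\<close>, which replaces \<open>w\<close> by the farther point \<open>e\<close>,
    and then from \<open>y2\<close> to \<open>c2\<close>.\<close>
  define e where "e = med M y2 c1 w"
  have eM: "e \<in> carrier M"
    using yM CM wM by (simp add: e_def med_closed)
  have we: "w \<in> interval x e"
    using interval_push[OF assms(1) CM(1) yM(2) y(1) w] yM CM wM by (simp add: e_def med_comm12)
  have e: "e \<in> interval y2 c1"
    using yM CM wM by (simp add: e_def med_in_interval)
  have "e \<in> interval x (med M c2 c1 e)"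
    by (rule interval_push[OF assms(1) CM(2) CM(1) y(2) e])
  then have "w \<in> interval x (med M c2 c1 e)"
    using interval_trans[OF assms(1) _ _ we] CM eM med_closed by blast
  moreover have "med M c2 c1 e \<in> C"
    using C c eM convexD by blast
  ultimately show "med M y1 y2 z \<in> (\<Union>c\<in>C. interval x c)"
    unfolding w_def by blast
qed

section \<open>Separation of convex sets by half spaces\<close>

lemma maximal_convex_disjoint:
  assumes "median_convex M A" "A \<inter> B = {}"
  obtains C where "median_convex M C" "A \<subseteq> C" "C \<inter> B = {}"
    "\<And>D. \<lbrakk>median_convex M D; C \<subseteq> D; D \<inter> B = {}\<rbrakk> \<Longrightarrow> D = C"
proof -
  define \<A> where "\<A> = {C. median_convex M C \<and> A \<subseteq> C \<and> C \<inter> B = {}}"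
  have "\<exists>C\<in>\<A>. \<forall>D\<in>\<A>. C \<subseteq> D \<longrightarrow> D = C"
  proof (rule subset_Zorn_nonempty)
    show "\<A> \<noteq> {}"
      using assms by (auto simp: \<A>_def)
  next
    fix \<C> assume ne: "\<C> \<noteq> {}" and chain: "subset.chain \<A> \<C>"
    have "\<C> \<subseteq> \<A>"
      using chain by (simp add: subset.chain_def)
    moreover have "median_convex M (\<Union>\<C>)"
    proof (rule convex_directed_Union)
      show "median_convex M C" if "C \<in> \<C>" for C
        using that \<open>\<C> \<subseteq> \<A>\<close> by (auto simp: \<A>_def)
      show "\<exists>E\<in>\<C>. C \<union> D \<subseteq> E" if "C \<in> \<C>" "D \<in> \<C>" for C D
        using chain that by (metis Un_absorb1 Un_absorb2 order_refl subset_chain_def)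
    qed
    ultimately show "\<Union>\<C> \<in> \<A>"
      using ne by (auto simp: \<A>_def)
  qed
  then obtain C where "C \<in> \<A>" "\<forall>D\<in>\<A>. C \<subseteq> D \<longrightarrow> D = C"
    by blast
  then show thesis
    using that[of C] by (auto simp: \<A>_def)
qed

text \<open>
  The join of \<open>x\<close> and \<open>C\<close> properly extends \<open>C\<close>, so maximality of \<open>C\<close> forces it to meet \<open>D\<close>.
\<close>

lemma maximal_join_meets:
  assumes C: "median_convex M C" "C \<noteq> {}"
    and max: "\<And>E. \<lbrakk>median_convex M E; C \<subseteq> E; E \<inter> D = {}\<rbrakk> \<Longrightarrow> E = C"
    and x: "x \<in> carrier M" "x \<notin> C"
  obtains c d where "c \<in> C" "d \<in> D" "d \<in> interval x c"
proof -
  let ?J = "\<Union>c\<in>C. interval x c"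
  have CM: "C \<subseteq> carrier M"
    using C by (simp add: median_convex_def)
  have "C \<subseteq> ?J" "x \<in> ?J"
    using CM C(2) x endpoint_in_interval by blast+
  then have "?J \<inter> D \<noteq> {}"
    using max[OF convex_join[OF x(1) C(1)]] x(2) by blast
  then show thesis
    using that by blast
qed

text \<open>
  Kakutani's separation theorem for median algebras: of two maximal disjoint convex sets each is the
  complement of the other.
\<close>

theorem half_space_separation:
  assumes A: "median_convex M A" and B: "median_convex M B" and disj: "A \<inter> B = {}"
  obtains H where "half_space M H" "A \<subseteq> H" "H \<inter> B = {}"
proof -
  have AM: "A \<subseteq> carrier M" and BM: "B \<subseteq> carrier M"
    using A B by (auto simp: median_convex_def)
  have triv: "half_space M {}" "half_space M (carrier M)"
    using med_closed by (simp_all add: half_space_def median_convex_def)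
  show thesis
  proof (cases "A = {} \<or> B = {}")
    case True
    then show thesis
      using triv AM that by auto
  next
    case False
    obtain C where C: "median_convex M C" "A \<subseteq> C" "C \<inter> B = {}"
      and Cmax: "\<And>E. \<lbrakk>median_convex M E; C \<subseteq> E; E \<inter> B = {}\<rbrakk> \<Longrightarrow> E = C"
      using maximal_convex_disjoint[OF A disj] by metis
    \<comment> \<open>\<open>C\<close> stays maximal when \<open>B\<close> is enlarged to \<open>D\<close>.\<close>
    obtain D where D: "median_convex M D" "B \<subseteq> D" "D \<inter> C = {}"
      and Dmax: "\<And>E. \<lbrakk>median_convex M E; D \<subseteq> E; E \<inter> C = {}\<rbrakk> \<Longrightarrow> E = D"
      using maximal_convex_disjoint[OF B, of C] C(3) by (metis Int_commute)
    have CM: "C \<subseteq> carrier M" and DM: "D \<subseteq> carrier M"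
      using C D by (auto simp: median_convex_def)
    have "x \<in> C \<union> D" if x: "x \<in> carrier M" for x
    proof (rule ccontr)
      assume "x \<notin> C \<union> D"
      then have "x \<notin> C" "x \<notin> D"
        by auto
      have "C \<noteq> {}" "D \<noteq> {}"
        using False C(2) D(2) by auto
      obtain c d where c: "c \<in> C" "d \<in> D" "d \<in> interval x c"
        using maximal_join_meets[OF C(1) \<open>C \<noteq> {}\<close> _ x \<open>x \<notin> C\<close>, of D] Cmax D(2) by blast
      obtain d' c' where d: "d' \<in> D" "c' \<in> C" "c' \<in> interval x d'"
        using maximal_join_meets[OF D(1) \<open>D \<noteq> {}\<close> Dmax x \<open>x \<notin> D\<close>] by blast
      have cd: "c \<in> carrier M" "d' \<in> carrier M"
        using c d CM DM by auto
      \<comment> \<open>The median of \<open>x\<close>, \<open>c\<close> and \<open>d'\<close> lies on both transversals, one inside \<open>C\<close> and one inside \<open>D\<close>.\<close>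
      have "med M x c d' \<in> interval c c'"
        by (rule interval_Pasch[OF x cd d(3)])
      moreover have "med M x d' c \<in> interval d' d"
        by (rule interval_Pasch[OF x cd(2,1) c(3)])
      ultimately have "med M x c d' \<in> C \<inter> D"
        using convex_interval_subset C(1) D(1) c d med_swap[OF x cd] by (metis IntI subsetD)
      then show False
        using D(3) by blast
    qed
    then have "carrier M - C = D"
      using CM DM D(3) by blast
    then have "half_space M C"
      using C(1) D(1) CM by (simp add: half_space_def)
    then show thesis
      using that C by blast
  qed
qed

text \<open>
  Two of the three points lie on the same side of \<open>H\<close>, and both sides are convex.  This is what makes
  the map from points to ultra filters of half spaces a median morphism.
\<close>

lemma half_space_med_iff:
  assumes "half_space M H" "x \<in> carrier M" "y \<in> carrier M" "z \<in> carrier M"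
  shows "med M x y z \<in> H \<longleftrightarrow> x \<in> H \<and> y \<in> H \<or> y \<in> H \<and> z \<in> H \<or> z \<in> H \<and> x \<in> H"
proof -
  have two: "med M x y z \<in> C"
    if "median_convex M C" "x \<in> C \<and> y \<in> C \<or> y \<in> C \<and> z \<in> C \<or> z \<in> C \<and> x \<in> C" for C
    using that assms(2-4) convexD med_comm12 med_comm13 med_swap by metis
  have "med M x y z \<in> carrier M"
    using assms by (simp add: med_closed)
  then show ?thesis
    using two[of H] two[of "carrier M - H"] assms unfolding half_space_def by blast
qed

lemma half_space_compl: "half_space M H \<Longrightarrow> half_space M (carrier M - H)"
  by (auto simp: half_space_def double_diff)

lemma half_space_subset: "half_space M H \<Longrightarrow> H \<subseteq> carrier M"
  by (simp add: half_space_def)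

lemma convex_singleton: "x \<in> carrier M \<Longrightarrow> median_convex M {x}"
  by (simp add: median_convex_def med_majority)

section \<open>Convex hulls and the Helly property\<close>

lemma convex_carrier: "median_convex M (carrier M)"
  by (simp add: median_convex_def med_closed)

lemma convex_hull_convex: "A \<subseteq> carrier M \<Longrightarrow> median_convex M (median_convex M hull A)"
  unfolding hull_def by (rule convex_Inter) (use convex_carrier in auto)

text \<open>
  The union of the hulls of the finite subsets of \<open>A\<close> is directed, hence convex.
\<close>

lemma convex_hull_finitary:
  assumes A: "A \<subseteq> carrier M" and x: "x \<in> median_convex M hull A"
  obtains F where "finite F" "F \<subseteq> A" "x \<in> median_convex M hull F"
proof -
  let ?\<F> = "{F. finite F \<and> F \<subseteq> A}"
  let ?U = "\<Union>F\<in>?\<F>. median_convex M hull F"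
  have "median_convex M ?U"
  proof (rule convex_directed_Union)
    show "median_convex M C" if "C \<in> (hull) (median_convex M) ` ?\<F>" for C
      using that A convex_hull_convex by auto
    show "\<exists>E\<in>(hull) (median_convex M) ` ?\<F>. C \<union> D \<subseteq> E"
      if CD: "C \<in> (hull) (median_convex M) ` ?\<F>" "D \<in> (hull) (median_convex M) ` ?\<F>" for C D
    proof -
      obtain F G where "F \<in> ?\<F>" "G \<in> ?\<F>" "C = median_convex M hull F" "D = median_convex M hull G"
        using CD by blast
      then have "F \<union> G \<in> ?\<F>" "C \<union> D \<subseteq> median_convex M hull (F \<union> G)"
        by (auto simp: hull_mono intro: subsetD[OF hull_mono, rotated])
      then show ?thesis
        by blast
    qed
  qed
  moreover have "A \<subseteq> ?U"
  proof
    fix a assume "a \<in> A"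
    then have "{a} \<in> ?\<F>" "a \<in> median_convex M hull {a}"
      by (auto intro: hull_inc)
    then show "a \<in> ?U"
      by blast
  qed
  ultimately have "median_convex M hull A \<subseteq> ?U"
    by (rule hull_minimal[rotated])
  then show thesis
    using x that by blast
qed

text \<open>
  Induction on the number of sets: once three pairwise meeting sets are known to have a common
  point (the median of points of the three pairwise intersections), the sets \<open>C j \<inter> C i\<close> with \<open>i\<close>
  fixed still meet pairwise, and there is one fewer of them.
\<close>

lemma Helly:
  assumes "finite I" "I \<noteq> {}"
    and "\<And>i. i \<in> I \<Longrightarrow> median_convex M (C i)"
    and "\<And>i j. \<lbrakk>i \<in> I; j \<in> I\<rbrakk> \<Longrightarrow> C i \<inter> C j \<noteq> {}"
  shows "(\<Inter>i\<in>I. C i) \<noteq> {}"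
  using assms
proof (induction I arbitrary: C rule: finite_ne_induct)
  case (singleton i)
  then show ?case
    by simp
next
  case (insert i I)
  have "(\<Inter>j\<in>I. C j \<inter> C i) \<noteq> {}"
  proof (rule insert.IH)
    show "median_convex M (C j \<inter> C i)" if "j \<in> I" for j
      using that insert.prems(1) by (simp add: convex_Int)
  next
    fix j k assume jk: "j \<in> I" "k \<in> I"
    obtain a b c where abc: "a \<in> C i \<inter> C j" "b \<in> C j \<inter> C k" "c \<in> C k \<inter> C i"
      using insert.prems(2)[of i j] insert.prems(2)[of j k] insert.prems(2)[of k i] jk by auto
    have conv: "median_convex M (C i)" "median_convex M (C j)" "median_convex M (C k)"
      using insert.prems(1) jk by auto
    then have M: "a \<in> carrier M" "b \<in> carrier M" "c \<in> carrier M"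
      using abc by (auto simp: median_convex_def)
    have "med M a b c \<in> C j"
      using convexD[OF conv(2)] abc M by auto
    moreover have "med M a b c \<in> C k"
      using convexD[OF conv(3), of b c a] abc M med_rotate med_swap by (metis IntE)
    moreover have "med M a b c \<in> C i"
      using convexD[OF conv(1), of a c b] abc M med_swap by (metis IntE)
    ultimately show "(C j \<inter> C i) \<inter> (C k \<inter> C i) \<noteq> {}"
      by blast
  qed
  then show ?case
    using insert.hyps by auto
qed

end

section \<open>Stone topologies\<close>

text \<open>
  All topologies of interest come with enough clopen sets, which gives the Hausdorff property and total
  disconnectedness at once.
\<close>

lemma Stone_space_if_clopen_separated:
  assumes "compact_space X"
    and sep: "\<And>x y. \<lbrakk>x \<in> topspace X; y \<in> topspace X; x \<noteq> y\<rbrakk>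
      \<Longrightarrow> \<exists>U. openin X U \<and> closedin X U \<and> (x \<in> U \<longleftrightarrow> y \<notin> U)"
  shows "Stone_space X"
proof -
  have "Hausdorff_space X"
    unfolding Hausdorff_space_def
  proof (intro allI impI)
    fix x y assume xy: "x \<in> topspace X \<and> y \<in> topspace X \<and> x \<noteq> y"
    then obtain U where U: "openin X U" "closedin X U" "x \<in> U \<longleftrightarrow> y \<notin> U"
      using sep by blast
    then have "openin X (topspace X - U)"
      by blast
    moreover have "disjnt U (topspace X - U)" "disjnt (topspace X - U) U"
      by (auto simp: disjnt_def)
    ultimately show "\<exists>U V. openin X U \<and> openin X V \<and> x \<in> U \<and> y \<in> V \<and> disjnt U V"
      using U xy by (cases "x \<in> U") blast+
  qed
  moreover have "\<exists>x. S \<subseteq> {x}" if S: "connectedin X S" for S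
  proof (rule ccontr)
    assume neg: "\<nexists>x. S \<subseteq> {x}"
    then obtain x where x: "x \<in> S"
      by blast
    with neg obtain y where y: "y \<in> S" "x \<noteq> y"
      by blast
    have "S \<subseteq> topspace X"
      using S by (rule connectedin_subset_topspace)
    then obtain U where U: "openin X U" "closedin X U" "x \<in> U \<longleftrightarrow> y \<notin> U"
      using sep[of x y] x y by blast
    then show False
      using connectedin_clopen_cases[OF S U(2,1)] x y by (auto simp: disjnt_def)
  qed
  ultimately show ?thesis
    using assms(1) by (simp add: Stone_space_def totally_disconnected_space_def)
qed

text \<open>
  Links the inductively generated topology to the description by finite intersections and unions that
  Alexander's subbase theorem speaks about.
\<close>

lemma topology_generated_by_eq_subbase:
  "topology_generated_by \<B> =
     topology (arbitrary union_of (finite intersection_of (\<lambda>x. x \<in> \<B>) relative_to \<Union>\<B>))"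
  (is "?X = ?Y")
proof -
  have sub: "openin ?Y S" if "S \<in> \<B>" for S
  proof -
    have "(finite intersection_of (\<lambda>x. x \<in> \<B>) relative_to \<Union>\<B>) (\<Union>\<B> \<inter> S)"
      using that by (intro relative_to_inc finite_intersection_of_inc)
    moreover have "\<Union>\<B> \<inter> S = S"
      using that by blast
    ultimately show ?thesis
      unfolding openin_subbase by (metis arbitrary_union_of_inc)
  qed
  have "openin ?Y S" if "generate_topology_on \<B> S" for S
    using that by induction (auto intro: sub)
  moreover have "openin ?X S" if "openin ?Y S" for S
  proof (rule minimal_topology_subbase[OF _ _ that])
    show "openin ?X (\<Union>\<B>)"
      using openin_topspace[of ?X] by simp
  qed (rule topology_generated_by_Basis)
  ultimately show ?thesis
    unfolding topology_eq openin_topology_generated_by_iff by blast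
qed

section \<open>The Stone poc set of half spaces\<close>

lemma circ_simps [simp]:
  "carrier (circ M) = {H. half_space M H}"
  "ple (circ M) = (\<subseteq>)"
  "pzero (circ M) = {}"
  "pstar (circ M) = (\<lambda>H. carrier M - H)"
  by (simp_all add: circ_def)

context median_algebra
begin

lemma half_space_carrier: "half_space M (carrier M)"
  using med_closed by (simp add: half_space_def median_convex_def)

lemma half_space_empty: "half_space M {}"
  using half_space_compl[OF half_space_carrier] by simp

lemma topspace_circ: "topspace (ptop (circ M)) = {H. half_space M H}"
  using nonempty by (auto simp: circ_def half_spaces_at_def)

lemma clopen_half_spaces_at:
  assumes "x \<in> carrier M"
  shows "openin (ptop (circ M)) (half_spaces_at M x)"
    and "closedin (ptop (circ M)) (half_spaces_at M x)"
    and "openin (ptop (circ M)) ({H. half_space M H} - half_spaces_at M x)"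
proof -
  show 1: "openin (ptop (circ M)) (half_spaces_at M x)"
    and 2: "openin (ptop (circ M)) ({H. half_space M H} - half_spaces_at M x)"
    using assms unfolding circ_def by (auto intro!: topology_generated_by_Basis)
  show "closedin (ptop (circ M)) (half_spaces_at M x)"
    using 2 by (auto simp: closedin_def topspace_circ half_spaces_at_def)
qed

lemma clopen_ultra_filter_half_spaces_at:
  assumes "x \<in> carrier M"
  shows "clopen_ultra_filter (circ M) (half_spaces_at M x)"
proof -
  have "H \<in> half_spaces_at M x \<union> (\<lambda>H. carrier M - H) ` half_spaces_at M x" if "half_space M H" for H
  proof (cases "x \<in> H")
    case False
    then have "carrier M - H \<in> half_spaces_at M x" "H = carrier M - (carrier M - H)"
      using assms that half_space_compl half_space_subset by (auto simp: half_spaces_at_def)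
    then show ?thesis
      by blast
  qed (use that in \<open>simp add: half_spaces_at_def\<close>)
  then have "ultra_filter (circ M) (half_spaces_at M x)"
    using half_space_compl by (auto simp: ultra_filter_def half_spaces_at_def)
  then show ?thesis
    using clopen_half_spaces_at[OF assms] by (simp add: clopen_ultra_filter_def)
qed

text \<open>
  A half space escapes a subbasic family when it misses all points \<open>A\<close> whose half spaces form a member
  of the family and contains all points \<open>B\<close> for which the complementary set is a member.  If none escapes, then by
  separation the hulls of \<open>A\<close> and \<open>B\<close> have a common point \<open>z\<close>, which already lies in the hulls of
  finite parts \<open>F\<close> and \<open>G\<close>, and no half space can escape the finite subcover given by these.
\<close>

lemma compact_space_circ: "compact_space (ptop (circ M))"
proof -
  let ?V = "half_spaces_at M" and ?V' = "\<lambda>x. {H. half_space M H} - half_spaces_at M x"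
  let ?B = "?V ` carrier M \<union> ?V' ` carrier M"
  have top: "ptop (circ M) = topology_generated_by ?B"
    by (simp add: circ_def)
  show ?thesis
  proof (rule Alexander_subbase[of ?B])
    show "topology (arbitrary union_of (finite intersection_of (\<lambda>x. x \<in> ?B) relative_to \<Union>?B))
        = ptop (circ M)"
      unfolding top by (rule topology_generated_by_eq_subbase[symmetric])
  next
    fix C assume C: "C \<subseteq> ?B" and cov: "\<Union>C = topspace (ptop (circ M))"
    define A where "A = {x \<in> carrier M. ?V x \<in> C}"
    define B where "B = {x \<in> carrier M. ?V' x \<in> C}"
    have AM: "A \<subseteq> carrier M" and BM: "B \<subseteq> carrier M"
      by (auto simp: A_def B_def)
    have "median_convex M hull B \<inter> median_convex M hull A \<noteq> {}"
    proof
      assume "median_convex M hull B \<inter> median_convex M hull A = {}"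
      then obtain H where H: "half_space M H"
        and sep: "median_convex M hull B \<subseteq> H" "H \<inter> median_convex M hull A = {}"
        using half_space_separation convex_hull_convex AM BM by metis
      have BH: "B \<subseteq> H" and AH: "H \<inter> A = {}"
        using sep hull_subset[of B "median_convex M"] hull_subset[of A "median_convex M"] by blast+
      have "H \<in> \<Union>C"
        using cov H by (simp add: topspace_circ)
      then obtain S where "S \<in> C" "H \<in> S"
        by blast
      then show False
        using C BH AH H by (auto simp: A_def B_def half_spaces_at_def)
    qed
    then obtain z where "z \<in> median_convex M hull A" "z \<in> median_convex M hull B"
      by blast
    then obtain F G where F: "finite F" "F \<subseteq> A" "z \<in> median_convex M hull F"
      and G: "finite G" "G \<subseteq> B" "z \<in> median_convex M hull G"
      using convex_hull_finitary AM BM by metis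
    have "\<exists>S \<in> ?V ` F \<union> ?V' ` G. H \<in> S" if H: "half_space M H" for H
    proof (rule ccontr)
      assume "\<not> ?thesis"
      then have "F \<subseteq> carrier M - H" "G \<subseteq> H"
        using H F(2) G(2) AM BM by (auto simp: half_spaces_at_def ball_Un)
      then have "z \<in> carrier M - H" "z \<in> H"
        using F(3) G(3) H hull_minimal[of _ _ "median_convex M"]
        unfolding half_space_def by blast+
      then show False
        by blast
    qed
    then have "topspace (ptop (circ M)) \<subseteq> \<Union>(?V ` F \<union> ?V' ` G)"
      by (auto simp: topspace_circ)
    moreover have "?V ` F \<union> ?V' ` G \<subseteq> C"
      using F(2) G(2) by (auto simp: A_def B_def)
    ultimately show "\<exists>C'. finite C' \<and> C' \<subseteq> C \<and> \<Union>C' = topspace (ptop (circ M))"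
      using F(1) G(1) cov by (intro exI[of _ "?V ` F \<union> ?V' ` G"]) blast
  qed
qed

theorem stone_poc_set_circ: "stone_poc_set (circ M)"
proof -
  have "Stone_space (ptop (circ M))"
  proof (rule Stone_space_if_clopen_separated[OF compact_space_circ])
    fix H K assume HK: "H \<in> topspace (ptop (circ M))" "K \<in> topspace (ptop (circ M))" "H \<noteq> K"
    then have "H \<subseteq> carrier M" "K \<subseteq> carrier M"
      using half_space_subset by (auto simp: topspace_circ)
    then obtain x where "x \<in> carrier M" "x \<in> H \<longleftrightarrow> x \<notin> K"
      using HK(3) by blast
    then show "\<exists>U. openin (ptop (circ M)) U \<and> closedin (ptop (circ M)) U \<and> (H \<in> U \<longleftrightarrow> K \<notin> U)"
      using HK clopen_half_spaces_at[of x]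
      by (intro exI[of _ "half_spaces_at M x"]) (auto simp: topspace_circ half_spaces_at_def)
  qed
  moreover have "\<exists>U. clopen_ultra_filter (circ M) U \<and> H \<in> U \<and> carrier M - K \<in> U"
    if HK: "half_space M H" "half_space M K" "\<not> H \<subseteq> K" for H K
  proof -
    obtain x where "x \<in> H" "x \<notin> K"
      using HK(3) by blast
    moreover then have "x \<in> carrier M"
      using half_space_subset[OF HK(1)] by blast
    ultimately show ?thesis
      using clopen_ultra_filter_half_spaces_at[of x] HK half_space_compl
      by (intro exI[of _ "half_spaces_at M x"]) (simp add: half_spaces_at_def)
  qed
  moreover have "carrier M - (carrier M - H) = H" if "half_space M H" for H
    using half_space_subset[OF that] by blast
  ultimately show ?thesis
    using nonempty half_space_empty half_space_compl half_space_subset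
    by unfold_locales
      (auto simp: topspace_circ intro: reflp_onI antisymp_onI transp_onI)
qed

lemma openin_half_spaces_containing:
  assumes "finite F" "F \<subseteq> carrier M"
  shows "openin (ptop (circ M)) {H. half_space M H \<and> F \<subseteq> H}"
  using assms
proof (induction F rule: finite_induct)
  case empty
  then show ?case
    using openin_topspace[of "ptop (circ M)"] by (simp add: topspace_circ)
next
  case (insert x F)
  then have "openin (ptop (circ M)) (half_spaces_at M x \<inter> {H. half_space M H \<and> F \<subseteq> H})"
    by (intro openin_Int clopen_half_spaces_at) auto
  also have "half_spaces_at M x \<inter> {H. half_space M H \<and> F \<subseteq> H}
      = {H. half_space M H \<and> insert x F \<subseteq> H}"
    by (auto simp: half_spaces_at_def)
  finally show ?case .
qed

text \<open>
  Compactness is used twice.  For \<open>H\<close> in \<open>U\<close>, each \<open>K\<close> outside \<open>U\<close> misses a point of \<open>H\<close>; as the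
  complement of \<open>U\<close> is compact, finitely many points \<open>f H\<close> of \<open>H\<close> serve all \<open>K\<close>, so containing
  \<open>f H\<close> implies membership in \<open>U\<close>.  As \<open>U\<close> is compact, finitely many of the sets \<open>f H\<close>
  account for all of \<open>U\<close>.
\<close>

lemma clopen_upper_set_finitely_generated:
  assumes U: "openin (ptop (circ M)) U" "closedin (ptop (circ M)) U"
    and up: "\<And>H K. \<lbrakk>H \<in> U; half_space M K; H \<subseteq> K\<rbrakk> \<Longrightarrow> K \<in> U"
  obtains \<F> where "finite \<F>" "\<F> \<subseteq> Pow (carrier M)"
    "U = {H. half_space M H \<and> (\<exists>F\<in>\<F>. F \<subseteq> H)}"
proof -
  let ?X = "ptop (circ M)" and ?T = "{H. half_space M H}"
  have UT: "U \<subseteq> ?T"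
    using openin_subset[OF U(1)] by (simp add: topspace_circ)
  have "\<exists>F. finite F \<and> F \<subseteq> H \<and> (\<forall>K. half_space M K \<and> F \<subseteq> K \<longrightarrow> K \<in> U)" if H: "H \<in> U" for H
  proof -
    let ?V' = "\<lambda>x. ?T - half_spaces_at M x"
    have HM: "H \<subseteq> carrier M"
      using H UT half_space_subset by blast
    have "closedin ?X (?T - U)"
      using closedin_diff[OF closedin_topspace U(1)] by (simp add: topspace_circ)
    then have compact: "compactin ?X (?T - U)"
      by (rule closedin_compact_space[OF compact_space_circ])
    have opens: "openin ?X S" if "S \<in> ?V' ` H" for S
      using that HM clopen_half_spaces_at(3) by blast
    have cover: "?T - U \<subseteq> \<Union>(?V' ` H)"
    proof
      fix K assume K: "K \<in> ?T - U"
      then obtain x where "x \<in> H" "x \<notin> K"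
        using up[OF H, of K] by blast
      then show "K \<in> \<Union>(?V' ` H)"
        using K by (auto simp: half_spaces_at_def)
    qed
    obtain \<G> where \<G>: "finite \<G>" "\<G> \<subseteq> ?V' ` H" "?T - U \<subseteq> \<Union>\<G>"
      using compactinD[OF compact opens cover] by blast
    then obtain F where F: "finite F" "F \<subseteq> H" "\<G> = ?V' ` F"
      using finite_subset_image[OF \<G>(1,2)] by blast
    have "K \<in> U" if "half_space M K" "F \<subseteq> K" for K
      using \<G>(3) that by (auto simp: F(3) half_spaces_at_def)
    then show ?thesis
      using F by blast
  qed
  then have "\<forall>H\<in>U. \<exists>F. finite F \<and> F \<subseteq> H \<and> (\<forall>K. half_space M K \<and> F \<subseteq> K \<longrightarrow> K \<in> U)"
    by simp
  from bchoice[OF this] obtain f where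
    "\<forall>H\<in>U. finite (f H) \<and> f H \<subseteq> H \<and> (\<forall>K. half_space M K \<and> f H \<subseteq> K \<longrightarrow> K \<in> U)" ..
  then have f: "finite (f H)" "f H \<subseteq> H"
    and fU: "\<And>K. \<lbrakk>half_space M K; f H \<subseteq> K\<rbrakk> \<Longrightarrow> K \<in> U" if "H \<in> U" for H
    using that by simp_all
  let ?W = "\<lambda>H. {K. half_space M K \<and> f H \<subseteq> K}"
  have fM: "f H \<subseteq> carrier M" if "H \<in> U" for H
    using f(2)[OF that] UT that half_space_subset by blast
  have compact: "compactin ?X U"
    by (rule closedin_compact_space[OF compact_space_circ U(2)])
  have opens: "openin ?X S" if "S \<in> ?W ` U" for S
    using that openin_half_spaces_containing[OF f(1) fM] by auto
  have cover: "U \<subseteq> \<Union>(?W ` U)"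
    using f(2) UT by auto
  obtain \<G> where \<G>: "finite \<G>" "\<G> \<subseteq> ?W ` U" "U \<subseteq> \<Union>\<G>"
    using compactinD[OF compact opens cover] by blast
  then obtain S where S: "finite S" "S \<subseteq> U" "\<G> = ?W ` S"
    using finite_subset_image[OF \<G>(1,2)] by blast
  show thesis
  proof (rule that[of "f ` S"])
    have "U \<subseteq> (\<Union>H\<in>S. ?W H)"
      using \<G>(3) unfolding S(3) .
    moreover have "(\<Union>H\<in>S. ?W H) \<subseteq> U"
      using S(2) fU by auto
    ultimately show "U = {H. half_space M H \<and> (\<exists>F\<in>f ` S. F \<subseteq> H)}"
      by auto
  qed (use S fM in auto)
qed

end

context poc_set
begin

lemma ultra_filter_iff:
  "ultra_filter P U \<longleftrightarrow>
     U \<subseteq> carrier P \<and> (\<forall>a\<in>U. \<forall>b\<in>carrier P. ple P a b \<longrightarrow> b \<in> U) \<and>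
     (\<forall>a\<in>carrier P. pstar P a \<in> U \<longleftrightarrow> a \<notin> U)"
proof (cases "U \<subseteq> carrier P")
  case True
  have img: "a \<in> pstar P ` U \<longleftrightarrow> pstar P a \<in> U" if "a \<in> carrier P" for a
  proof
    assume "a \<in> pstar P ` U"
    then show "pstar P a \<in> U"
      using True star_star by fastforce
  next
    assume "pstar P a \<in> U"
    then show "a \<in> pstar P ` U"
      using star_star[OF that] by (metis imageI)
  qed
  have "pstar P ` U \<subseteq> carrier P"
    using True star_closed by blast
  then have "U \<inter> pstar P ` U = {} \<and> U \<union> pstar P ` U = carrier P \<longleftrightarrow>
      (\<forall>a\<in>carrier P. a \<in> pstar P ` U \<longleftrightarrow> a \<notin> U)"
    using True by blast
  also have "\<dots> \<longleftrightarrow> (\<forall>a\<in>carrier P. pstar P a \<in> U \<longleftrightarrow> a \<notin> U)"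
    by (simp add: img)
  finally show ?thesis
    by (simp add: ultra_filter_def)
qed (simp add: ultra_filter_def)

lemma ultra_filter_subset: "ultra_filter P U \<Longrightarrow> U \<subseteq> carrier P"
  by (simp add: ultra_filter_iff)

lemma ultra_filter_upper:
  "\<lbrakk>ultra_filter P U; a \<in> U; b \<in> carrier P; ple P a b\<rbrakk> \<Longrightarrow> b \<in> U"
  by (simp add: ultra_filter_iff)

lemma star_in_ultra_filter_iff:
  "\<lbrakk>ultra_filter P U; a \<in> carrier P\<rbrakk> \<Longrightarrow> pstar P a \<in> U \<longleftrightarrow> a \<notin> U"
  by (simp add: ultra_filter_iff)

lemma zero_notin_ultra_filter:
  assumes "ultra_filter P U"
  shows "pzero P \<notin> U"
proof
  assume "pzero P \<in> U"
  then have "pstar P (pzero P) \<in> U"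
    using assms ultra_filter_upper zero_closed star_closed zero_least by metis
  then show False
    using \<open>pzero P \<in> U\<close> assms star_in_ultra_filter_iff zero_closed by metis
qed

lemma ultra_filter_subset_eq:
  assumes "ultra_filter P U" "ultra_filter P W" "U \<subseteq> W"
  shows "U = W"
proof
  show "W \<subseteq> U"
  proof
    fix a assume a: "a \<in> W"
    then have "a \<in> carrier P"
      using ultra_filter_subset[OF assms(2)] by blast
    then show "a \<in> U"
      using a assms(3) star_in_ultra_filter_iff[OF assms(1)] star_in_ultra_filter_iff[OF assms(2)]
      by blast
  qed
qed (rule assms(3))

end

context median_algebra
begin

text \<open>
  The common point of the hulls of the generating sets lies in every member of \<open>U\<close>.  Thus \<open>U\<close> is
  contained in the ultra filter of half spaces at that point, and ultra filters are incomparable.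
\<close>

theorem clopen_ultra_filter_circ:
  assumes U: "clopen_ultra_filter (circ M) U"
  obtains x where "x \<in> carrier M" "U = half_spaces_at M x"
proof -
  interpret C: stone_poc_set "circ M"
    by (rule stone_poc_set_circ)
  have uf: "ultra_filter (circ M) U"
    and clopen: "openin (ptop (circ M)) U" "closedin (ptop (circ M)) U"
    using U by (simp_all add: clopen_ultra_filter_def)
  have UT: "U \<subseteq> {H. half_space M H}"
    using C.ultra_filter_subset[OF uf] by simp
  have up: "K \<in> U" if "H \<in> U" "half_space M K" "H \<subseteq> K" for H K
    using C.ultra_filter_upper[OF uf] that by simp
  have whole: "carrier M \<in> U"
    using C.star_in_ultra_filter_iff[OF uf, of "{}"] C.zero_notin_ultra_filter[OF uf]
    by (simp add: half_space_empty)
  obtain \<F> where \<F>: "finite \<F>" "\<F> \<subseteq> Pow (carrier M)"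
    and U_eq: "U = {H. half_space M H \<and> (\<exists>F\<in>\<F>. F \<subseteq> H)}"
    using clopen up by (rule clopen_upper_set_finitely_generated)
  have \<F>M: "F \<subseteq> carrier M" if "F \<in> \<F>" for F
    using \<F>(2) that by blast
  have hullM: "median_convex M hull F \<subseteq> H" if "half_space M H" "F \<subseteq> H" for F H
    using that hull_minimal[of F H] by (simp add: half_space_def)
  have "(\<Inter>F\<in>\<F>. median_convex M hull F) \<noteq> {}"
  proof (rule Helly[OF \<F>(1)])
    show "\<F> \<noteq> {}"
      using whole by (auto simp: U_eq)
    show "median_convex M (median_convex M hull F)" if "F \<in> \<F>" for F
      using \<F>M[OF that] by (rule convex_hull_convex)
  next
    fix F G assume FG: "F \<in> \<F>" "G \<in> \<F>"
    show "median_convex M hull F \<inter> median_convex M hull G \<noteq> {}"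
    proof
      assume "median_convex M hull F \<inter> median_convex M hull G = {}"
      then obtain H where H: "half_space M H"
        and sep: "median_convex M hull F \<subseteq> H" "H \<inter> median_convex M hull G = {}"
        using half_space_separation convex_hull_convex \<F>M FG by metis
      have "F \<subseteq> H" "G \<subseteq> carrier M - H"
        using sep hull_subset[of F "median_convex M"] hull_subset[of G "median_convex M"]
          \<F>M[OF FG(2)] by blast+
      then have "H \<in> U" "carrier M - H \<in> U"
        using H half_space_compl FG by (auto simp: U_eq)
      then show False
        using C.star_in_ultra_filter_iff[OF uf, of H] H by simp
    qed
  qed
  then obtain x where x: "\<And>F. F \<in> \<F> \<Longrightarrow> x \<in> median_convex M hull F"
    by blast
  have sub: "x \<in> H" if "H \<in> U" for H
    using that x hullM by (auto simp: U_eq)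
  have xM: "x \<in> carrier M"
    using whole by (rule sub)
  have "U \<subseteq> half_spaces_at M x"
    using sub UT by (auto simp: half_spaces_at_def)
  then have "U = half_spaces_at M x"
    using C.ultra_filter_subset_eq[OF uf] clopen_ultra_filter_half_spaces_at[OF xM]
    by (simp add: clopen_ultra_filter_def)
  then show thesis
    using that xM by blast
qed

end

section \<open>The median algebra of clopen ultra filters\<close>

lemma bullet_simps [simp]:
  "carrier (bullet P) = {U. clopen_ultra_filter P U}"
  "med (bullet P) = (\<lambda>U V W. (U \<inter> V) \<union> (V \<inter> W) \<union> (W \<inter> U))"
  by (simp_all add: bullet_def)

context stone_poc_set
begin

lemma clopen_ultra_filterD:
  assumes "clopen_ultra_filter P U"
  shows "ultra_filter P U" "openin (ptop P) U" "closedin (ptop P) U"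
  using assms by (simp_all add: clopen_ultra_filter_def)

lemma ultra_filter_median:
  assumes "ultra_filter P U" "ultra_filter P V" "ultra_filter P W"
  shows "ultra_filter P ((U \<inter> V) \<union> (V \<inter> W) \<union> (W \<inter> U))"
  unfolding ultra_filter_iff
proof (intro conjI ballI impI)
  show "(U \<inter> V) \<union> (V \<inter> W) \<union> (W \<inter> U) \<subseteq> carrier P"
    using assms ultra_filter_subset by blast
next
  fix a b assume "a \<in> (U \<inter> V) \<union> (V \<inter> W) \<union> (W \<inter> U)" "b \<in> carrier P" "ple P a b"
  then show "b \<in> (U \<inter> V) \<union> (V \<inter> W) \<union> (W \<inter> U)"
    using assms[THEN ultra_filter_upper, of a b] by blast
next
  fix a assume "a \<in> carrier P"
  then show "pstar P a \<in> (U \<inter> V) \<union> (V \<inter> W) \<union> (W \<inter> U)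
      \<longleftrightarrow> a \<notin> (U \<inter> V) \<union> (V \<inter> W) \<union> (W \<inter> U)"
    using assms[THEN star_in_ultra_filter_iff, of a] by blast
qed

theorem median_algebra_bullet: "median_algebra (bullet P)"
proof
  \<comment> \<open>Clopen ultra filters exist because separation applies to \<open>0\<^sup>*\<close> and \<open>0\<close>.\<close>
  have "\<not> ple P (pstar P (pzero P)) (pzero P)"
    using zero_neq_star zero_least[OF star_closed[OF zero_closed]]
      antisymp_onD[OF ple_antisym] zero_closed star_closed by metis
  then show "carrier (bullet P) \<noteq> {}"
    using separation[OF star_closed[OF zero_closed] zero_closed] by auto
next
  fix U V W assume "U \<in> carrier (bullet P)" "V \<in> carrier (bullet P)" "W \<in> carrier (bullet P)"
  then show "med (bullet P) U V W \<in> carrier (bullet P)"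
    by (simp add: clopen_ultra_filter_def ultra_filter_median openin_Un openin_Int
        closedin_Un closedin_Int)
qed auto

sublocale bullet: median_algebra "bullet P"
  by (rule median_algebra_bullet)

lemma half_space_bulletI:
  assumes "a \<in> carrier P"
  shows "half_space (bullet P) {U. clopen_ultra_filter P U \<and> a \<in> U}"
proof -
  have "med (bullet P) U V W \<in> carrier (bullet P)"
    if "clopen_ultra_filter P U" "clopen_ultra_filter P V" "clopen_ultra_filter P W" for U V W
    using bullet.med_closed that by simp
  then show ?thesis
    by (auto simp: half_space_def median_convex_def)
qed

text \<open>
  With respect to \<open>W\<close> as least element, the element found is the meet of a point of \<open>C\<close> with all of \<open>F\<close>: the
  median of \<open>U\<close>, \<open>V\<close> and \<open>W\<close> contains, apart from elements of \<open>W\<close>, only what \<open>U\<close> and \<open>V\<close> share.  It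
  stays in \<open>C\<close> by convexity, because \<open>U\<close> and \<open>V\<close> are in \<open>C\<close>.
\<close>

lemma meet_in_convex:
  assumes "median_convex (bullet P) C" "C \<noteq> {}" "clopen_ultra_filter P W" "finite F" "F \<subseteq> C"
  shows "\<exists>U\<in>C. \<forall>V\<in>F. U - W \<subseteq> V"
  using assms(4,5)
proof (induction F rule: finite_induct)
  case empty
  then show ?case
    using assms(2) by auto
next
  case (insert V F)
  then obtain U where U: "U \<in> C" "\<forall>V\<in>F. U - W \<subseteq> V"
    by blast
  have "med (bullet P) U V W \<in> C"
    using bullet.convexD[OF assms(1) U(1)] insert.prems assms(3) by simp
  moreover have "med (bullet P) U V W - W \<subseteq> U \<inter> V"
    by auto
  ultimately show ?case
    using U(2) by blast
qed

text \<open>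
  The same construction from the opposite side: inside \<open>U\<close>, the median of \<open>W\<close>, \<open>V\<close> and \<open>U\<close> contains
  everything in \<open>V\<close> or \<open>W\<close>.
\<close>

lemma join_in_convex:
  assumes "median_convex (bullet P) C" "C \<noteq> {}" "clopen_ultra_filter P U" "finite F" "F \<subseteq> C"
  shows "\<exists>W\<in>C. \<forall>V\<in>F. U \<inter> V \<subseteq> W"
  using assms(4,5)
proof (induction F rule: finite_induct)
  case empty
  then show ?case
    using assms(2) by auto
next
  case (insert V F)
  then obtain W where W: "W \<in> C" "\<forall>V\<in>F. U \<inter> V \<subseteq> W"
    by blast
  have "med (bullet P) W V U \<in> C"
    using bullet.convexD[OF assms(1) W(1)] insert.prems assms(3) by simp
  moreover have "U \<inter> (V \<union> W) \<subseteq> med (bullet P) W V U"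
    by auto
  ultimately show ?case
    using W(2) by (intro bexI[of _ "med (bullet P) W V U"]) auto
qed

text \<open>
  First all of \<open>G\<close> is absorbed into one \<open>W\<close>, as seen from some \<open>U0\<close> in \<open>H\<close>; then \<open>F\<close> together with
  \<open>U0\<close> is absorbed into one \<open>U\<close>, as seen from \<open>W\<close>.  Including \<open>U0\<close> in the second step puts the elements of
  \<open>U - W\<close> into \<open>U0\<close>, where avoiding \<open>W\<close> means avoiding all of \<open>G\<close>.
\<close>

lemma finite_separation:
  assumes H: "median_convex (bullet P) H" "H \<noteq> {}" and D: "median_convex (bullet P) D" "D \<noteq> {}"
    and disj: "H \<inter> D = {}" and F: "finite F" "F \<subseteq> H" and G: "finite G" "G \<subseteq> D"
  shows "\<exists>a\<in>carrier P. (\<forall>U\<in>F. a \<in> U) \<and> (\<forall>W\<in>G. a \<notin> W)"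
proof -
  have clopen: "clopen_ultra_filter P U" if "U \<in> H \<union> D" for U
    using that H(1) D(1) by (auto simp: median_convex_def)
  obtain U0 where U0: "U0 \<in> H"
    using H(2) by blast
  obtain W where W: "W \<in> D" "\<forall>V\<in>G. U0 \<inter> V \<subseteq> W"
    using join_in_convex[OF D clopen G, of U0] U0 by blast
  have "insert U0 F \<subseteq> H"
    using U0 F(2) by blast
  then obtain U where U: "U \<in> H" "\<forall>V\<in>insert U0 F. U - W \<subseteq> V"
    using meet_in_convex[OF H clopen, of W "insert U0 F"] W(1) F(1) by blast
  have uf: "ultra_filter P U" "ultra_filter P W"
    using clopen U(1) W(1) clopen_ultra_filterD(1) by blast+
  have "U \<noteq> W"
    using disj U(1) W(1) by blast
  then obtain a where a: "a \<in> U" "a \<notin> W"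
    using ultra_filter_subset_eq[OF uf] by blast
  have "a \<in> carrier P"
    using a(1) ultra_filter_subset[OF uf(1)] by blast
  moreover have "a \<in> V" if "V \<in> insert U0 F" for V
    using U(2) a that by blast
  ultimately show ?thesis
    using W(2) a(2) by blast
qed

text \<open>
  The members of \<open>H\<close> and the complements of the other clopen ultra filters are closed subsets of \<open>P\<close>
  with the finite intersection property.  Since \<open>P\<close> is compact, they have a common element \<open>a\<close>.  The
  two trivial half spaces are given by the zero and its star.
\<close>

theorem half_space_bullet:
  assumes H: "half_space (bullet P) H"
  obtains a where "a \<in> carrier P" "H = {U. clopen_ultra_filter P U \<and> a \<in> U}"
proof -
  let ?D = "carrier (bullet P) - H"
  have conv: "median_convex (bullet P) H" "median_convex (bullet P) ?D" and HM: "H \<subseteq> carrier (bullet P)"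
    using H by (simp_all add: half_space_def)
  consider "H = {}" | "?D = {}" | "H \<noteq> {}" "?D \<noteq> {}"
    by blast
  then show thesis
  proof cases
    case 1
    then show thesis
      using that[OF zero_closed] clopen_ultra_filterD(1) zero_notin_ultra_filter by blast
  next
    case 2
    have "pstar P (pzero P) \<in> U" if "clopen_ultra_filter P U" for U
      using that clopen_ultra_filterD(1) zero_notin_ultra_filter star_in_ultra_filter_iff zero_closed
      by blast
    then have "H = {U. clopen_ultra_filter P U \<and> pstar P (pzero P) \<in> U}"
      using 2 HM by auto
    then show thesis
      using that[OF star_closed[OF zero_closed]] by blast
  next
    case 3
    define \<C> where "\<C> = H \<union> (\<lambda>W. carrier P - W) ` ?D"
    have HD: "clopen_ultra_filter P U" if "U \<in> H \<union> ?D" for U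
      using that HM by auto
    have closed: "closedin (ptop P) C" if C: "C \<in> \<C>" for C
    proof -
      consider "C \<in> H" | W where "W \<in> ?D" "C = topspace (ptop P) - W"
        using C unfolding \<C>_def topspace_eq by blast
      then show ?thesis
        using HD[THEN clopen_ultra_filterD(2)] HD[THEN clopen_ultra_filterD(3)]
        by cases (auto intro: closedin_diff)
    qed
    have fip: "\<Inter>\<F> \<noteq> {}" if \<F>: "finite \<F>" "\<F> \<subseteq> \<C>" for \<F>
    proof -
      \<comment> \<open>\<open>?G\<close> recovers the non-members of \<open>H\<close> from their complements and is finite as an image of
        \<open>\<F>\<close>.\<close>
      let ?F = "\<F> \<inter> H" and ?G = "(\<lambda>X. carrier P - X) ` \<F> \<inter> ?D"
      have "\<exists>a\<in>carrier P. (\<forall>U\<in>?F. a \<in> U) \<and> (\<forall>W\<in>?G. a \<notin> W)"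
        using finite_separation[OF conv(1) 3(1) conv(2) 3(2), of ?F ?G] \<F>(1) by auto
      then obtain a where a: "a \<in> carrier P" "\<forall>U\<in>?F. a \<in> U" "\<forall>W\<in>?G. a \<notin> W"
        by (elim bexE conjE)
      have "a \<in> C" if C: "C \<in> \<F>" for C
      proof -
        consider "C \<in> H" | W where "W \<in> ?D" "C = carrier P - W"
          using C \<F>(2) unfolding \<C>_def by blast
        then show ?thesis
        proof cases
          case 1
          then show ?thesis
            using a(2) C by blast
        next
          case (2 W)
          then have "W \<subseteq> carrier P"
            using HD clopen_ultra_filterD(1) ultra_filter_subset by blast
          then have "W = carrier P - C"
            using 2(2) by blast
          then have "W \<in> ?G"
            using C 2(1) by blast
          then show ?thesis
            using a(1) bspec[OF a(3), of W] 2(2) by simp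
        qed
      qed
      then show ?thesis
        by blast
    qed
    have "compact_space (ptop P)"
      using Stone by (simp add: Stone_space_def)
    then have "\<Inter>\<C> \<noteq> {}"
      using closed fip unfolding compact_space_fip by simp
    then obtain a where a: "\<And>C. C \<in> \<C> \<Longrightarrow> a \<in> C"
      by blast
    have aH: "a \<in> U" if "U \<in> H" for U
      using a that by (simp add: \<C>_def)
    have aD: "a \<notin> W" if "W \<in> ?D" for W
      using a[of "carrier P - W"] that unfolding \<C>_def by blast
    obtain U0 where "U0 \<in> H"
      using 3(1) by blast
    then have "a \<in> carrier P"
      using aH HD clopen_ultra_filterD(1) ultra_filter_subset by blast
    moreover have "H = {U. clopen_ultra_filter P U \<and> a \<in> U}"
      using aH aD HM by auto
    ultimately show thesis
      by (rule that)
  qed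
qed

end

section \<open>Functoriality and naturality\<close>

lemma median_homD:
  assumes "f \<in> median_hom M N"
  shows "x \<in> carrier M \<Longrightarrow> f x \<in> carrier N"
    and "\<lbrakk>x \<in> carrier M; y \<in> carrier M; z \<in> carrier M\<rbrakk>
      \<Longrightarrow> f (med M x y z) = med N (f x) (f y) (f z)"
  using assms by (auto simp: median_hom_def)

lemma stone_poc_homD:
  assumes "f \<in> stone_poc_hom P Q"
  shows "a \<in> carrier P \<Longrightarrow> f a \<in> carrier Q"
    and "\<lbrakk>a \<in> carrier P; b \<in> carrier P; ple P a b\<rbrakk> \<Longrightarrow> ple Q (f a) (f b)"
    and "f (pzero P) = pzero Q"
    and "a \<in> carrier P \<Longrightarrow> f (pstar P a) = pstar Q (f a)"
    and "continuous_map (ptop P) (ptop Q) f"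
  using assms by (auto simp: stone_poc_hom_def monotone_on_def)

lemma half_space_vimage:
  assumes "median_algebra M" "f \<in> median_hom M N" "half_space N H"
  shows "half_space M (f -` H \<inter> carrier M)"
proof -
  interpret M: median_algebra M
    by (rule assms(1))
  note f = median_homD[OF assms(2)]
  have "median_convex M (f -` C \<inter> carrier M)" if "median_convex N C" for C
    using that f(1,2) M.med_closed by (auto simp: median_convex_def)
  moreover have "carrier M - (f -` H \<inter> carrier M) = f -` (carrier N - H) \<inter> carrier M"
    using f(1) by auto
  ultimately show ?thesis
    using assms(3) by (simp add: half_space_def)
qed

lemma clopen_ultra_filter_vimage:
  assumes "stone_poc_set P" "stone_poc_set Q" "g \<in> stone_poc_hom P Q" "clopen_ultra_filter Q U"
  shows "clopen_ultra_filter P (g -` U \<inter> carrier P)"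
proof -
  interpret P: stone_poc_set P
    by (rule assms(1))
  interpret Q: stone_poc_set Q
    by (rule assms(2))
  note g = stone_poc_homD[OF assms(3)] and U = Q.clopen_ultra_filterD[OF assms(4)]
  have eq: "g -` U \<inter> carrier P = {a \<in> topspace (ptop P). g a \<in> U}"
    by (auto simp: P.topspace_eq)
  have "ultra_filter P (g -` U \<inter> carrier P)"
    unfolding P.ultra_filter_iff
    using g(1,2,4) P.star_closed Q.ultra_filter_upper[OF U(1)] Q.star_in_ultra_filter_iff[OF U(1)]
    by auto
  moreover have "openin (ptop P) (g -` U \<inter> carrier P)" "closedin (ptop P) (g -` U \<inter> carrier P)"
    unfolding eq using openin_continuous_map_preimage[OF g(5) U(2)]
      closedin_continuous_map_preimage[OF g(5) U(3)] .
  ultimately show ?thesis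
    by (simp add: clopen_ultra_filter_def)
qed

text \<open>
  The preimage of the half spaces at \<open>x\<close> under the induced map is the set of half spaces at \<open>f x\<close>,
  whence continuity.
\<close>

theorem circ_map_hom:
  assumes "median_algebra M" "median_algebra N" "f \<in> median_hom M N"
  shows "circ_map M N f \<in> stone_poc_hom (circ N) (circ M)"
proof -
  interpret M: median_algebra M
    by (rule assms(1))
  interpret N: median_algebra N
    by (rule assms(2))
  let ?f = "circ_map M N f"
  note f = median_homD[OF assms(3)]
  have f_eq: "?f H = f -` H \<inter> carrier M" if "half_space N H" for H
    using that by (simp add: circ_map_def)
  have hs: "half_space M (?f H)" if "half_space N H" for H
    using half_space_vimage[OF assms(1,3) that] f_eq[OF that] by simp
  have "continuous_map (ptop (circ N)) (ptop (circ M)) ?f"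
    unfolding circ_def[of M] poc_struct.simps stone_poc_struct.simps
  proof (rule continuous_on_generated_topo)
    fix S
    assume "S \<in> half_spaces_at M ` carrier M \<union>
      (\<lambda>x. {H. half_space M H} - half_spaces_at M x) ` carrier M"
    then consider x where "x \<in> carrier M" "S = half_spaces_at M x"
      | x where "x \<in> carrier M" "S = {H. half_space M H} - half_spaces_at M x"
      by blast
    then show "openin (ptop (circ N)) (?f -` S \<inter> topspace (ptop (circ N)))"
    proof cases
      case (1 x)
      then have "?f -` S \<inter> topspace (ptop (circ N)) = half_spaces_at N (f x)"
        using hs f_eq by (auto simp: N.topspace_circ half_spaces_at_def)
      then show ?thesis
        using N.clopen_half_spaces_at(1) f(1) 1 by simp
    next
      case (2 x)
      then have "?f -` S \<inter> topspace (ptop (circ N)) = {H. half_space N H} - half_spaces_at N (f x)"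
        using hs f_eq by (auto simp: N.topspace_circ half_spaces_at_def)
      then show ?thesis
        using N.clopen_half_spaces_at(3) f(1) 2 by simp
    qed
  next
    show "?f ` topspace (ptop (circ N)) \<subseteq> \<Union>(half_spaces_at M ` carrier M \<union>
      (\<lambda>x. {H. half_space M H} - half_spaces_at M x) ` carrier M)"
      using hs M.nonempty by (auto simp: N.topspace_circ half_spaces_at_def)
  qed
  moreover have "?f (carrier N - H) = carrier M - ?f H" if "half_space N H" for H
    using that f_eq N.half_space_compl f(1) by auto
  moreover have "?f \<in> extensional (carrier (circ N))"
    unfolding circ_map_def by simp
  ultimately show ?thesis
    using hs f_eq N.half_space_empty
    by (auto simp: stone_poc_hom_def PiE_def monotone_on_def)
qed

lemma circ_map_id:
  assumes "median_algebra M"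
  shows "circ_map M M (\<lambda>x\<in>carrier M. x) = (\<lambda>H\<in>carrier (circ M). H)"
  unfolding circ_map_def
proof (rule restrict_ext)
  fix H assume "H \<in> carrier (circ M)"
  then have "H \<subseteq> carrier M"
    using median_algebra.half_space_subset[OF assms] by simp
  then show "(\<lambda>x\<in>carrier M. x) -` H \<inter> carrier M = H"
    by auto
qed

lemma circ_map_compose:
  assumes "median_algebra M" "f \<in> median_hom L M" "g \<in> median_hom M N"
  shows "circ_map L N (compose (carrier L) g f) =
    compose (carrier (circ N)) (circ_map L M f) (circ_map M N g)"
proof
  fix H
  show "circ_map L N (compose (carrier L) g f) H =
      compose (carrier (circ N)) (circ_map L M f) (circ_map M N g) H"
    using half_space_vimage[OF assms(1,3), of H] median_homD(1)[OF assms(2)]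
    by (cases "half_space N H") (auto simp: circ_map_def compose_def)
qed

theorem bullet_map_hom:
  assumes "stone_poc_set P" "stone_poc_set Q" "g \<in> stone_poc_hom P Q"
  shows "bullet_map P Q g \<in> median_hom (bullet Q) (bullet P)"
proof -
  interpret Q: stone_poc_set Q
    by (rule assms(2))
  have "med (bullet Q) U V W \<in> carrier (bullet Q)"
    if "clopen_ultra_filter Q U" "clopen_ultra_filter Q V" "clopen_ultra_filter Q W" for U V W
    using Q.bullet.med_closed that by simp
  then show ?thesis
    using clopen_ultra_filter_vimage[OF assms] by (auto simp: median_hom_def bullet_map_def)
qed

lemma bullet_map_id:
  assumes "stone_poc_set P"
  shows "bullet_map P P (\<lambda>a\<in>carrier P. a) = (\<lambda>U\<in>carrier (bullet P). U)"
proof -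
  interpret P: stone_poc_set P
    by (rule assms)
  show ?thesis
    unfolding bullet_map_def
  proof (rule restrict_ext)
    fix U assume "U \<in> carrier (bullet P)"
    then have "U \<subseteq> carrier P"
      using P.ultra_filter_subset[OF P.clopen_ultra_filterD(1)] by simp
    then show "(\<lambda>a\<in>carrier P. a) -` U \<inter> carrier P = U"
      by auto
  qed
qed

lemma bullet_map_compose:
  assumes "stone_poc_set Q" "stone_poc_set R" "f \<in> stone_poc_hom P Q" "g \<in> stone_poc_hom Q R"
  shows "bullet_map P R (compose (carrier P) g f) =
    compose (carrier (bullet R)) (bullet_map P Q f) (bullet_map Q R g)"
proof
  fix U
  show "bullet_map P R (compose (carrier P) g f) U =
      compose (carrier (bullet R)) (bullet_map P Q f) (bullet_map Q R g) U"
    using clopen_ultra_filter_vimage[OF assms(1,2,4), of U] stone_poc_homD(1)[OF assms(3)]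
    by (cases "clopen_ultra_filter R U") (auto simp: bullet_map_def compose_def)
qed

lemma median_ev_eq: "x \<in> carrier M \<Longrightarrow> median_ev M x = half_spaces_at M x"
  by (simp add: median_ev_def half_spaces_at_def)

lemma poc_ev_eq: "a \<in> carrier P \<Longrightarrow> poc_ev P a = {U. clopen_ultra_filter P U \<and> a \<in> U}"
  by (simp add: poc_ev_def)

lemma median_ev_natural:
  assumes "median_algebra M" "f \<in> median_hom M N"
  shows "compose (carrier M) (median_ev N) f =
    compose (carrier M) (bullet_map (circ N) (circ M) (circ_map M N f)) (median_ev M)"
proof
  fix x
  show "compose (carrier M) (median_ev N) f x =
      compose (carrier M) (bullet_map (circ N) (circ M) (circ_map M N f)) (median_ev M) x"
  proof (cases "x \<in> carrier M")
    case True
    then show ?thesis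
      using median_homD(1)[OF assms(2)] half_space_vimage[OF assms]
        median_algebra.clopen_ultra_filter_half_spaces_at[OF assms(1)]
      by (auto simp: compose_def median_ev_eq bullet_map_def circ_map_def half_spaces_at_def)
  qed (simp add: compose_def)
qed

lemma poc_ev_natural:
  assumes "stone_poc_set P" "stone_poc_set Q" "g \<in> stone_poc_hom P Q"
  shows "compose (carrier P) (poc_ev Q) g =
    compose (carrier P) (circ_map (bullet Q) (bullet P) (bullet_map P Q g)) (poc_ev P)"
proof
  fix a
  show "compose (carrier P) (poc_ev Q) g a =
      compose (carrier P) (circ_map (bullet Q) (bullet P) (bullet_map P Q g)) (poc_ev P) a"
  proof (cases "a \<in> carrier P")
    case True
    then show ?thesis
      using stone_poc_homD(1)[OF assms(3)] clopen_ultra_filter_vimage[OF assms]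
        stone_poc_set.half_space_bulletI[OF assms(1)]
      by (auto simp: compose_def poc_ev_eq bullet_map_def circ_map_def)
  qed (simp add: compose_def)
qed

section \<open>Evaluation maps are isomorphisms\<close>

lemma median_isoI:
  assumes "median_algebra M" "median_algebra N" and f: "f \<in> median_hom M N"
    and bij: "bij_betw f (carrier M) (carrier N)"
  shows "median_iso M N f"
proof -
  interpret M: median_algebra M
    by (rule assms(1))
  interpret N: median_algebra N
    by (rule assms(2))
  let ?g = "restrict (inv_into (carrier M) f) (carrier N)"
  have gf: "?g (f x) = x" if "x \<in> carrier M" for x
    using that bij median_homD(1)[OF f] by (simp add: bij_betw_inv_into_left)
  have fg: "f (?g y) = y" and gM: "?g y \<in> carrier M" if "y \<in> carrier N" for y
    using that bij bij_betwE[OF bij_betw_inv_into[OF bij]] by (simp_all add: bij_betw_inv_into_right)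
  have "?g (med N x y z) = med M (?g x) (?g y) (?g z)"
    if "x \<in> carrier N" "y \<in> carrier N" "z \<in> carrier N" for x y z
  proof -
    have "f (med M (?g x) (?g y) (?g z)) = med N x y z"
      using median_homD(2)[OF f] gM fg that by simp
    then show ?thesis
      using gf M.med_closed gM that by metis
  qed
  then have "?g \<in> median_hom N M"
    using gM by (auto simp: median_hom_def)
  then show ?thesis
    using f gf fg unfolding median_iso_def
    by (intro conjI bexI[of _ ?g]) (auto simp: compose_def intro!: restrict_ext)
qed

text \<open>
  Reflecting the order makes \<open>f\<close> injective and its inverse monotone; the inverse is continuous because
  \<open>P\<close> is compact and \<open>Q\<close> is Hausdorff.
\<close>

lemma stone_poc_isoI:
  assumes P: "stone_poc_set P" and Q: "stone_poc_set Q" and f: "f \<in> stone_poc_hom P Q"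
    and surj: "f ` carrier P = carrier Q"
    and reflects: "\<And>a b. \<lbrakk>a \<in> carrier P; b \<in> carrier P; ple Q (f a) (f b)\<rbrakk> \<Longrightarrow> ple P a b"
  shows "stone_poc_iso P Q f"
proof -
  interpret P: stone_poc_set P
    by (rule P)
  interpret Q: stone_poc_set Q
    by (rule Q)
  note f' = stone_poc_homD[OF f]
  have inj: "inj_on f (carrier P)"
  proof (rule inj_onI)
    fix a b assume ab: "a \<in> carrier P" "b \<in> carrier P" "f a = f b"
    have "ple Q (f a) (f a)"
      using reflp_onD[OF Q.ple_refl f'(1)[OF ab(1)]] .
    then have "ple P a b" "ple P b a"
      using reflects ab by simp_all
    then show "a = b"
      using antisymp_onD[OF P.ple_antisym ab(1,2)] by blast
  qed
  have "homeomorphic_map (ptop P) (ptop Q) f"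
    using continuous_imp_homeomorphic_map[OF f'(5)] P.Stone Q.Stone surj inj
    by (simp add: Stone_space_def P.topspace_eq Q.topspace_eq)
  then obtain g' where "homeomorphic_maps (ptop P) (ptop Q) f g'"
    unfolding homeomorphic_map_maps by blast
  then have cont: "continuous_map (ptop Q) (ptop P) g'"
    and gf': "\<And>a. a \<in> carrier P \<Longrightarrow> g' (f a) = a" and fg': "\<And>b. b \<in> carrier Q \<Longrightarrow> f (g' b) = b"
    by (simp_all add: homeomorphic_maps_def P.topspace_eq Q.topspace_eq)
  let ?g = "restrict g' (carrier Q)"
  have gP: "?g b \<in> carrier P" if "b \<in> carrier Q" for b
    using that continuous_map_image_subset_topspace[OF cont] P.topspace_eq Q.topspace_eq by auto
  have gf: "?g (f a) = a" if "a \<in> carrier P" for a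
    using that gf' f'(1) by simp
  have fg: "f (?g b) = b" if "b \<in> carrier Q" for b
    using that fg' by simp
  have "continuous_map (ptop Q) (ptop P) ?g"
    by (rule continuous_map_eq[OF cont]) (simp add: Q.topspace_eq)
  moreover have "?g (pzero Q) = pzero P"
    using gf[OF P.zero_closed] f'(3) by simp
  moreover have "?g (pstar Q b) = pstar P (?g b)" if "b \<in> carrier Q" for b
    using gf[OF P.star_closed[OF gP[OF that]]] f'(4)[OF gP[OF that]] fg[OF that] by metis
  moreover have "ple P (?g b) (?g c)" if "b \<in> carrier Q" "c \<in> carrier Q" "ple Q b c" for b c
    using reflects[OF gP gP] fg that by simp
  ultimately have "?g \<in> stone_poc_hom Q P"
    unfolding stone_poc_hom_def PiE_def monotone_on_def using gP by auto
  then show ?thesis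
    using f gf fg unfolding stone_poc_iso_def
    by (intro conjI bexI[of _ ?g]) (auto simp: compose_def intro!: restrict_ext)
qed

theorem median_iso_median_ev:
  assumes "median_algebra M"
  shows "median_iso M (bullet (circ M)) (median_ev M)"
proof -
  interpret M: median_algebra M
    by (rule assms)
  interpret C: stone_poc_set "circ M"
    by (rule M.stone_poc_set_circ)
  show ?thesis
  proof (rule median_isoI[OF assms C.median_algebra_bullet])
    have "median_ev M (med M x y z) =
        med (bullet (circ M)) (median_ev M x) (median_ev M y) (median_ev M z)"
      if "x \<in> carrier M" "y \<in> carrier M" "z \<in> carrier M" for x y z
      using that M.half_space_med_iff[OF _ that] M.med_closed
      by (auto simp: median_ev_eq half_spaces_at_def)
    then show "median_ev M \<in> median_hom M (bullet (circ M))"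
      using M.clopen_ultra_filter_half_spaces_at
      by (auto simp: median_hom_def PiE_def median_ev_eq) (simp add: median_ev_def)
    show "bij_betw (median_ev M) (carrier M) (carrier (bullet (circ M)))"
      unfolding bij_betw_def
    proof
      show "inj_on (median_ev M) (carrier M)"
      proof (rule inj_onI, rule ccontr)
        fix x y assume xy: "x \<in> carrier M" "y \<in> carrier M" "median_ev M x = median_ev M y" "x \<noteq> y"
        then obtain H where "half_space M H" "{x} \<subseteq> H" "H \<inter> {y} = {}"
          using M.half_space_separation[OF M.convex_singleton M.convex_singleton, of x y] by auto
        then show False
          using xy by (auto simp: median_ev_eq half_spaces_at_def)
      qed
      show "median_ev M ` carrier M = carrier (bullet (circ M))"
      proof
        show "median_ev M ` carrier M \<subseteq> carrier (bullet (circ M))"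
          using M.clopen_ultra_filter_half_spaces_at by (auto simp: median_ev_eq)
        show "carrier (bullet (circ M)) \<subseteq> median_ev M ` carrier M"
        proof
          fix U assume "U \<in> carrier (bullet (circ M))"
          then obtain x where "x \<in> carrier M" "U = half_spaces_at M x"
            using M.clopen_ultra_filter_circ by auto
          then show "U \<in> median_ev M ` carrier M"
            by (metis imageI median_ev_eq)
        qed
      qed
    qed
  qed
qed

text \<open>
  Pulling back the half spaces of \<open>P\<^sup>\<bullet>\<close> at the point \<open>U\<close> gives \<open>U\<close> itself, so evaluation is
  continuous exactly because the points of \<open>P\<^sup>\<bullet>\<close> are clopen.
\<close>

theorem stone_poc_iso_poc_ev:
  assumes "stone_poc_set P"
  shows "stone_poc_iso P (circ (bullet P)) (poc_ev P)"
proof -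
  interpret P: stone_poc_set P
    by (rule assms)
  let ?ev = "poc_ev P"
  have hs: "half_space (bullet P) (?ev a)" if "a \<in> carrier P" for a
    using that P.half_space_bulletI by (simp add: poc_ev_eq)
  show ?thesis
  proof (rule stone_poc_isoI[OF assms P.bullet.stone_poc_set_circ])
    have "continuous_map (ptop P) (ptop (circ (bullet P))) ?ev"
      unfolding circ_def[of "bullet P"] poc_struct.simps stone_poc_struct.simps
    proof (rule continuous_on_generated_topo)
      fix S
      assume "S \<in> half_spaces_at (bullet P) ` carrier (bullet P) \<union>
        (\<lambda>U. {H. half_space (bullet P) H} - half_spaces_at (bullet P) U) ` carrier (bullet P)"
      then consider U where "clopen_ultra_filter P U" "S = half_spaces_at (bullet P) U"
        | U where "clopen_ultra_filter P U"
            "S = {H. half_space (bullet P) H} - half_spaces_at (bullet P) U"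
        by auto
      then show "openin (ptop P) (?ev -` S \<inter> topspace (ptop P))"
      proof cases
        case (1 U)
        then have "?ev -` S \<inter> topspace (ptop P) = U"
          using hs P.ultra_filter_subset[OF P.clopen_ultra_filterD(1)[OF 1(1)]]
          by (auto simp: P.topspace_eq half_spaces_at_def poc_ev_eq)
        then show ?thesis
          using P.clopen_ultra_filterD(2)[OF 1(1)] by simp
      next
        case (2 U)
        then have "?ev -` S \<inter> topspace (ptop P) = topspace (ptop P) - U"
          using hs by (auto simp: P.topspace_eq half_spaces_at_def poc_ev_eq)
        then show ?thesis
          using P.clopen_ultra_filterD(3)[OF 2(1)] by (simp add: closedin_def)
      qed
    next
      show "?ev ` topspace (ptop P) \<subseteq> \<Union>(half_spaces_at (bullet P) ` carrier (bullet P) \<union>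
        (\<lambda>U. {H. half_space (bullet P) H} - half_spaces_at (bullet P) U) ` carrier (bullet P))"
        using hs P.bullet.nonempty by (auto simp: P.topspace_eq half_spaces_at_def)
    qed
    moreover have "?ev (pzero P) = {}"
      using P.zero_notin_ultra_filter P.clopen_ultra_filterD(1)
      by (auto simp: poc_ev_eq P.zero_closed)
    moreover have "?ev (pstar P a) = carrier (bullet P) - ?ev a" if "a \<in> carrier P" for a
      using P.star_in_ultra_filter_iff[OF P.clopen_ultra_filterD(1) that]
      by (auto simp: poc_ev_eq that P.star_closed)
    moreover have "?ev a \<subseteq> ?ev b" if "a \<in> carrier P" "b \<in> carrier P" "ple P a b" for a b
      using that P.ultra_filter_upper[OF P.clopen_ultra_filterD(1)] by (auto simp: poc_ev_eq)
    moreover have "?ev \<in> extensional (carrier P)"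
      by (simp add: poc_ev_def)
    ultimately show "?ev \<in> stone_poc_hom P (circ (bullet P))"
      using hs by (auto simp: stone_poc_hom_def PiE_def monotone_on_def)
    show "?ev ` carrier P = carrier (circ (bullet P))"
    proof
      show "?ev ` carrier P \<subseteq> carrier (circ (bullet P))"
        using hs by auto
      show "carrier (circ (bullet P)) \<subseteq> ?ev ` carrier P"
      proof
        fix H assume "H \<in> carrier (circ (bullet P))"
        then obtain a where "a \<in> carrier P" "H = {U. clopen_ultra_filter P U \<and> a \<in> U}"
          using P.half_space_bullet by auto
        then show "H \<in> ?ev ` carrier P"
          by (metis imageI poc_ev_eq)
      qed
    qed
    show "ple P a b" if ab: "a \<in> carrier P" "b \<in> carrier P" "ple (circ (bullet P)) (?ev a) (?ev b)"
      for a b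
    proof (rule ccontr)
      assume "\<not> ple P a b"
      then obtain U where U: "clopen_ultra_filter P U" "a \<in> U" "pstar P b \<in> U"
        using P.separation ab by blast
      then have "b \<notin> U"
        using P.star_in_ultra_filter_iff[OF P.clopen_ultra_filterD(1)] ab by blast
      then show False
        using U ab by (auto simp: poc_ev_eq)
    qed
  qed
qed

section \<open>The duality\<close>

theorem theorem6p4:
  shows
    "\<comment> \<open>\<open>circ\<close> is a contravariant functor from median algebras to Stone poc sets\<close>
     (\<forall>M :: 'a median_struct. median_algebra M \<longrightarrow> stone_poc_set (circ M)) \<and>
     (\<forall>(M :: 'a median_struct) (N :: 'b median_struct) f.
        median_algebra M \<and> median_algebra N \<and> f \<in> median_hom M N \<longrightarrow>
        circ_map M N f \<in> stone_poc_hom (circ N) (circ M)) \<and>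
     (\<forall>M :: 'a median_struct. median_algebra M \<longrightarrow>
        circ_map M M (\<lambda>x\<in>carrier M. x) = (\<lambda>H\<in>carrier (circ M). H)) \<and>
     (\<forall>(L :: 'a median_struct) (M :: 'b median_struct) (N :: 'c median_struct) f g.
        median_algebra L \<and> median_algebra M \<and> median_algebra N \<and>
        f \<in> median_hom L M \<and> g \<in> median_hom M N \<longrightarrow>
        circ_map L N (compose (carrier L) g f) =
          compose (carrier (circ N)) (circ_map L M f) (circ_map M N g)) \<and>
     \<comment> \<open>\<open>bullet\<close> is a contravariant functor from Stone poc sets to median algebras\<close>
     (\<forall>P :: 'a stone_poc_struct. stone_poc_set P \<longrightarrow> median_algebra (bullet P)) \<and>
     (\<forall>(P :: 'a stone_poc_struct) (Q :: 'b stone_poc_struct) g.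
        stone_poc_set P \<and> stone_poc_set Q \<and> g \<in> stone_poc_hom P Q \<longrightarrow>
        bullet_map P Q g \<in> median_hom (bullet Q) (bullet P)) \<and>
     (\<forall>P :: 'a stone_poc_struct. stone_poc_set P \<longrightarrow>
        bullet_map P P (\<lambda>a\<in>carrier P. a) = (\<lambda>U\<in>carrier (bullet P). U)) \<and>
     (\<forall>(P :: 'a stone_poc_struct) (Q :: 'b stone_poc_struct) (R :: 'c stone_poc_struct) f g.
        stone_poc_set P \<and> stone_poc_set Q \<and> stone_poc_set R \<and>
        f \<in> stone_poc_hom P Q \<and> g \<in> stone_poc_hom Q R \<longrightarrow>
        bullet_map P R (compose (carrier P) g f) =
          compose (carrier (bullet R)) (bullet_map P Q f) (bullet_map Q R g)) \<and>
     \<comment> \<open>evaluation is a natural isomorphism from the identity to \<open>bullet \<circ> circ\<close>\<close>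
     (\<forall>M :: 'a median_struct. median_algebra M \<longrightarrow>
        median_iso M (bullet (circ M)) (median_ev M)) \<and>
     (\<forall>(M :: 'a median_struct) (N :: 'b median_struct) f.
        median_algebra M \<and> median_algebra N \<and> f \<in> median_hom M N \<longrightarrow>
        compose (carrier M) (median_ev N) f =
          compose (carrier M) (bullet_map (circ N) (circ M) (circ_map M N f)) (median_ev M)) \<and>
     \<comment> \<open>evaluation is a natural isomorphism from the identity to \<open>circ \<circ> bullet\<close>\<close>
     (\<forall>P :: 'a stone_poc_struct. stone_poc_set P \<longrightarrow>
        stone_poc_iso P (circ (bullet P)) (poc_ev P)) \<and>
     (\<forall>(P :: 'a stone_poc_struct) (Q :: 'b stone_poc_struct) g.
        stone_poc_set P \<and> stone_poc_set Q \<and> g \<in> stone_poc_hom P Q \<longrightarrow>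
        compose (carrier P) (poc_ev Q) g =
          compose (carrier P) (circ_map (bullet Q) (bullet P) (bullet_map P Q g)) (poc_ev P))"
  by (intro conjI allI impI; (elim conjE)?;
      rule median_algebra.stone_poc_set_circ circ_map_hom circ_map_id circ_map_compose
        stone_poc_set.median_algebra_bullet bullet_map_hom bullet_map_id bullet_map_compose
        median_iso_median_ev median_ev_natural stone_poc_iso_poc_ev poc_ev_natural;
      assumption)

end
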